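(* Let $(X,\mathcal{B},\mu)$ be a standard probability space, let $r\geq 2$ be an integer, and let $\mathfrak{P}_r$ be the collection of all finite measurable partitions of $X$ with at most $r$ atoms. For a subset $K$ of $\mathfrak{P}_r$, the following assertions are equivalent: (1) $K$ is precompact in the Rokhlin metric $\rho$ on $\mathfrak{P}_r$; (2) the maximal pattern entropy $h^*_\mu(K)$ of $K$ is zero; (3) the set $\{\mathbf{1}_A\colon A\in\alpha\in K\}$ is precompact in $L^2(\mu)$; (4) $K$ has bounded mean complexity (with respect to the Hamming distance).
   Context: A finite partition of $X$ is a finite collection of pairwise disjoint measurable sets (atoms) whose union is $X$ modulo $\mu$-null sets; two partitions are identified if each atom of either one is, mod $0$, a union of atoms of the other. For partitions $\alpha,\beta$, $\alpha\vee\beta=\{A\cap B\colon A\in\alpha,B\in\beta\}$. Entropy: $H_\mu(\alpha)=-\sum_{A\in\alpha}\mu(A)\log\mu(A)$ (with $0\log 0=0$). Conditional entropy: $H_\mu(\alpha|\beta)=\sum_{B\in\beta}\mu(B)\sum_{A\in\alpha}-\mu(A|B)\log\mu(A|B)$, where $\mu(A|B)=\mu(A\cap B)/\mu(B)$ if $\mu(B)>0$ and $0$ otherwise. The Rokhlin metric is $\rho(\alpha,\beta)=H_\mu(\alpha|\beta)+H_\mu(\beta|\alpha)$. Maximal pattern entropy: for $K\subset\mathfrak{P}_r$ and $n\in\mathbb{N}$, $P^*_{K,\mu}(n)=\sup_{\alpha_1,\dots,\alpha_n\in K}H_\mu(\bigvee_{i=1}^n\alpha_i)$ and $h^*_\mu(K)=\limsup_{n\to\infty}\frac1n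 P^*_{K,\mu}(n)$. Bounded mean complexity: for a finite nonempty $E\subset\mathfrak{P}_r$ and $x,y\in X$, the normalized Hamming distance is $H_E(x,y)=\frac{1}{|E|}\,|\{\alpha\in E\colon x,y \text{ lie in different atoms of }\alpha\}|$. Put $B_{H_E}(x,\varepsilon)=\{y\colon H_E(x,y)<\varepsilon\}$ and $\mathcal{C}(E,\varepsilon)=\min\{|D|\colon D\subset X \text{ finite},\ \mu(\bigcup_{x\in D}B_{H_E}(x,\varepsilon))>1-\varepsilon\}$. A set $K\subset\mathfrak{P}_r$ has bounded mean complexity if for every $\varepsilon>0$ there is $C\in\mathbb{N}$ with $\mathcal{C}(E,\varepsilon)\leq C$ for every finite nonempty subset $E$ of $K$. *)

theory Defs
  imports "HOL-Probability.Probability"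
begin

definition is_partition :: "'a measure \<Rightarrow> nat \<Rightarrow> 'a set set \<Rightarrow> bool" where
  "is_partition M r \<alpha> \<longleftrightarrow> finite \<alpha> \<and> card \<alpha> \<le> r \<and> \<alpha> \<subseteq> sets M \<and> disjoint \<alpha>
      \<and> measure M (space M - \<Union>\<alpha>) = 0"

definition partitions :: "'a measure \<Rightarrow> nat \<Rightarrow> 'a set set set" where
  "partitions M r = {\<alpha>. is_partition M r \<alpha>}"

definition union_mod0 :: "'a measure \<Rightarrow> 'a set \<Rightarrow> 'a set set \<Rightarrow> bool" where
  "union_mod0 M A \<beta> \<longleftrightarrow> (\<exists>\<gamma>\<subseteq>\<beta>. measure M ((A - \<Union>\<gamma>) \<union> (\<Union>\<gamma> - A)) = 0)"

definition partition_equiv :: "'a measure \<Rightarrow> 'a set set \<Rightarrow> 'a set set \<Rightarrow> bool" where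
  "partition_equiv M \<alpha> \<beta> \<longleftrightarrow> (\<forall>A\<in>\<alpha>. union_mod0 M A \<beta>) \<and> (\<forall>B\<in>\<beta>. union_mod0 M B \<alpha>)"

definition plogp :: "real \<Rightarrow> real" where
  "plogp p = (if p = 0 then 0 else p * ln p)"

definition entropy_part :: "'a measure \<Rightarrow> 'a set set \<Rightarrow> real" where
  "entropy_part M \<alpha> = (\<Sum>A\<in>\<alpha>. - plogp (measure M A))"

definition cond_prob :: "'a measure \<Rightarrow> 'a set \<Rightarrow> 'a set \<Rightarrow> real" where
  "cond_prob M A B = (if measure M B > 0 then measure M (A \<inter> B) / measure M B else 0)"

definition cond_entropy_part :: "'a measure \<Rightarrow> 'a set set \<Rightarrow> 'a set set \<Rightarrow> real" where
  "cond_entropy_part M \<alpha> \<beta> =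
     (\<Sum>B\<in>\<beta>. measure M B * (\<Sum>A\<in>\<alpha>. - plogp (cond_prob M A B)))"

definition rokhlin :: "'a measure \<Rightarrow> 'a set set \<Rightarrow> 'a set set \<Rightarrow> real" where
  "rokhlin M \<alpha> \<beta> = cond_entropy_part M \<alpha> \<beta> + cond_entropy_part M \<beta> \<alpha>"

definition join_n :: "'a measure \<Rightarrow> (nat \<Rightarrow> 'a set set) \<Rightarrow> nat \<Rightarrow> 'a set set" where
  "join_n M \<alpha>s n = {space M \<inter> (\<Inter>i<n. f i) | f. \<forall>i<n. f i \<in> \<alpha>s i}"

text \<open>Maximal pattern entropy (entropy is nonnegative, so adding 0 to the set
  only fixes the convention for empty K).\<close>
definition max_pattern_P :: "'a measure \<Rightarrow> 'a set set set \<Rightarrow> nat \<Rightarrow> real" where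
  "max_pattern_P M K n =
     Sup ({0} \<union> {entropy_part M (join_n M \<alpha>s n) | \<alpha>s. \<forall>i<n. \<alpha>s i \<in> K})"

definition max_pattern_entropy :: "'a measure \<Rightarrow> 'a set set set \<Rightarrow> ereal" where
  "max_pattern_entropy M K = limsup (\<lambda>n. ereal (max_pattern_P M K n / real n))"

definition rho_precompact :: "'a measure \<Rightarrow> nat \<Rightarrow> 'a set set set \<Rightarrow> bool" where
  "rho_precompact M r K \<longleftrightarrow>
     (\<forall>a::nat \<Rightarrow> 'a set set. (\<forall>n. a n \<in> K) \<longrightarrow>
        (\<exists>\<sigma> \<beta>. strict_mono \<sigma> \<and> \<beta> \<in> partitions M r \<and>
                (\<lambda>n. rokhlin M (a (\<sigma> n)) \<beta>) \<longlonglongrightarrow> 0))"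

definition L2_precompact :: "'a measure \<Rightarrow> ('a \<Rightarrow> real) set \<Rightarrow> bool" where
  "L2_precompact M S \<longleftrightarrow>
     (\<forall>f::nat \<Rightarrow> 'a \<Rightarrow> real. (\<forall>n. f n \<in> S) \<longrightarrow>
        (\<exists>\<sigma> g. strict_mono \<sigma> \<and> g \<in> borel_measurable M \<and> integrable M (\<lambda>x. (g x)^2) \<and>
               (\<lambda>n. sqrt (LINT x|M. (f (\<sigma> n) x - g x)^2)) \<longlonglongrightarrow> 0))"

definition atom_indicators :: "'a set set set \<Rightarrow> ('a \<Rightarrow> real) set" where
  "atom_indicators K = {indicator A | A \<alpha>. \<alpha> \<in> K \<and> A \<in> \<alpha>}"

definition hamming :: "'a set set set \<Rightarrow> 'a \<Rightarrow> 'a \<Rightarrow> real" where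
  "hamming E x y =
     real (card {\<alpha>\<in>E. \<not> (\<exists>A\<in>\<alpha>. x \<in> A \<and> y \<in> A)}) / real (card E)"

definition hball :: "'a measure \<Rightarrow> 'a set set set \<Rightarrow> 'a \<Rightarrow> real \<Rightarrow> 'a set" where
  "hball M E x \<epsilon> = {y \<in> space M. hamming E x y < \<epsilon>}"

definition mean_complexity :: "'a measure \<Rightarrow> 'a set set set \<Rightarrow> real \<Rightarrow> nat" where
  "mean_complexity M E \<epsilon> =
     (LEAST k. \<exists>D. finite D \<and> D \<subseteq> space M \<and> card D = k \<and>
                  measure M (\<Union>x\<in>D. hball M E x \<epsilon>) > 1 - \<epsilon>)"

text \<open>Finite subsets E of K are taken with pairwise non-identified elements,
  i.e. they correspond to finite sets of partitions (classes mod 0).\<close>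
definition bounded_mean_complexity :: "'a measure \<Rightarrow> 'a set set set \<Rightarrow> bool" where
  "bounded_mean_complexity M K \<longleftrightarrow>
     (\<forall>\<epsilon>>0. \<exists>C::nat. \<forall>E. finite E \<and> E \<noteq> {} \<and> E \<subseteq> K \<and>
         pairwise (\<lambda>\<alpha> \<beta>. \<not> partition_equiv M \<alpha> \<beta>) E \<longrightarrow> mean_complexity M E \<epsilon> \<le> C)"

end

theory Submission
  imports Defs "HOL-Library.Diagonal_Subsequence"
begin

text \<open>All four conditions are equivalent to a fifth one: for every \<open>\<eta> > 0\<close> there is one finite family \<open>S\<close>
  of measurable sets such that every \<open>\<alpha> \<in> K\<close> agrees, off a set of measure at most \<open>\<eta>\<close>, with a
  partition measurable with respect to the algebra generated by \<open>S\<close>. An atom of this algebra is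
  encoded by the subfamily of \<open>S\<close> consisting of the sets that contain it, so that passing to a
  common refinement is just taking the union of families.

  If the condition fails, a greedy choice gives \<open>\<alpha>\<^sub>0, \<alpha>\<^sub>1, \<dots> \<in> K\<close> such that no \<open>\<alpha>\<^sub>n\<close> is
  \<open>\<eta>\<close>-approximable from its predecessors. Since \<open>\<alpha>\<close> is \<open>H(\<alpha>|\<beta>)\<close>-approximable from \<open>\<beta>\<close>,
  the entropy of the joins then grows at least by \<open>\<eta>\<close> in each step, and no subsequence converges in
  the Rokhlin metric. Centres of few Hamming balls covering most of \<open>X\<close> show that half of the first
  \<open>n\<close> partitions are approximable from these balls, so by the pigeonhole principle two of them would be close
  to each other. Conversely, Fano's inequality bounds \<open>H(\<alpha>|\<beta>)\<close> when \<open>\<alpha>\<close> is well approximable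
  from \<open>\<beta>\<close>, which makes the entropy of joins grow slowly; Markov's inequality gives the Hamming
  balls; and a diagonal argument gives convergent subsequences of labelled partitions, hence both
  kinds of precompactness.\<close>

section \<open>Approximation by finite families of sets\<close>

definition pattern :: "'a set set \<Rightarrow> 'a \<Rightarrow> 'a set set" where
  "pattern S x = {A \<in> S. x \<in> A}"

text \<open>Here \<open>f\<close> guesses, from the pattern of a point, the atom that contains it,
  and the error set collects the points where the guess fails. Only values at patterns that occur
  matter, but \<open>approximable\<close> constrains the whole range, hence the default atoms in the
  guesses constructed below.\<close>

definition error_set :: "'a measure \<Rightarrow> 'a set set \<Rightarrow> ('a set set \<Rightarrow> 'a set) \<Rightarrow> 'a set" where
  "error_set M S f = {x \<in> space M. x \<notin> f (pattern S x)}"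

definition approximable :: "'a measure \<Rightarrow> 'a set set \<Rightarrow> 'a set set \<Rightarrow> real \<Rightarrow> bool" where
  "approximable M \<alpha> S \<eta> \<longleftrightarrow> (\<exists>f. range f \<subseteq> \<alpha> \<and> measure M (error_set M S f) \<le> \<eta>)"

definition uniformly_approximable :: "'a measure \<Rightarrow> 'a set set set \<Rightarrow> bool" where
  "uniformly_approximable M K \<longleftrightarrow>
     (\<forall>\<eta>>0. \<exists>S. finite S \<and> S \<subseteq> sets M \<and> (\<forall>\<alpha>\<in>K. approximable M \<alpha> S \<eta>))"

lemma pattern_in_Pow: "pattern S x \<in> Pow S"
  by (auto simp: pattern_def)

lemma pattern_partition:
  assumes "disjoint \<beta>" "B \<in> \<beta>" "x \<in> B"
  shows "pattern \<beta> x = {B}"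
  using assms by (auto simp: pattern_def disjoint_def)

lemma pattern_measurable:
  assumes "finite S" "S \<subseteq> sets M"
  shows "{x \<in> space M. pattern S x = T} \<in> sets M"
proof (cases "T \<subseteq> S")
  case True
  have "{x \<in> space M. pattern S x = T} = {x \<in> space M. \<forall>A\<in>S. x \<in> A \<longleftrightarrow> A \<in> T}"
    using True by (auto simp: pattern_def)
  also have "\<dots> \<in> sets M"
    using assms by (intro sets.sets_Collect_finite_All) auto
  finally show ?thesis .
next
  case False
  then have "{x \<in> space M. pattern S x = T} = {}"
    by (auto simp: pattern_def)
  then show ?thesis by (simp only: sets.empty_sets)
qed

lemma error_set_measurable:
  assumes "finite S" "S \<subseteq> sets M" "range f \<subseteq> sets M"
  shows "error_set M S f \<in> sets M"
proof -
  have "error_set M S f = (\<Union>T\<in>Pow S. {x \<in> space M. pattern S x = T} - f T)"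
    using pattern_in_Pow[of S] unfolding error_set_def by blast
  also have "\<dots> \<in> sets M"
  proof (intro sets.finite_UN)
    show "{x \<in> space M. pattern S x = T} - f T \<in> sets M" for T
      using pattern_measurable[OF assms(1,2)] assms(3) by (meson range_subsetD sets.Diff)
  qed (use assms(1) in simp)
  finally show ?thesis .
qed

lemma is_partitionD:
  assumes "is_partition M r \<alpha>"
  shows "finite \<alpha>" "card \<alpha> \<le> r" "\<alpha> \<subseteq> sets M" "disjoint \<alpha>" "\<Union>\<alpha> \<in> sets M"
    "measure M (space M - \<Union>\<alpha>) = 0"
  using assms by (auto simp: is_partition_def)

context prob_space
begin

lemma is_partition_null:
  assumes "is_partition M r \<alpha>"
  shows "space M - \<Union>\<alpha> \<in> null_sets M"
proof -
  have "space M - \<Union>\<alpha> \<in> sets M"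
    using is_partitionD[OF assms] by auto
  then show ?thesis
    using is_partitionD(6)[OF assms] by (auto simp: null_sets_def emeasure_eq_measure)
qed

lemma is_partition_nonempty:
  assumes "is_partition M r \<alpha>"
  shows "\<alpha> \<noteq> {}"
  using assms by (auto simp: is_partition_def prob_space)

section \<open>Monotonicity, refinement and composition of approximations\<close>

lemma approximable_mono:
  "approximable M \<alpha> S \<eta> \<Longrightarrow> \<eta> \<le> \<theta> \<Longrightarrow> approximable M \<alpha> S \<theta>"
  by (auto simp: approximable_def intro: order_trans)

text \<open>A guess from the \<open>S\<close>-pattern becomes a guess from the
  \<open>T\<close>-pattern by evaluating it at a representative point with the given
  \<open>T\<close>-pattern; \<open>refine\<close> makes the choice of representative irrelevant. The
  null set \<open>N\<close> accommodates partitions that cover the space only mod 0.\<close>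

lemma approximable_refine:
  assumes "finite S" "S \<subseteq> sets M" "\<alpha> \<subseteq> sets M" "N \<in> null_sets M"
    and refine: "\<And>x y. x \<in> space M - N \<Longrightarrow> y \<in> space M - N \<Longrightarrow> pattern T x = pattern T y
      \<Longrightarrow> pattern S x = pattern S y"
    and "approximable M \<alpha> S \<eta>"
  shows "approximable M \<alpha> T \<eta>"
proof -
  from assms obtain f where f: "range f \<subseteq> \<alpha>" "prob (error_set M S f) \<le> \<eta>"
    by (auto simp: approximable_def)
  define g where "g U = f (pattern S (SOME y. y \<in> space M - N \<and> pattern T y = U))" for U
  have S: "error_set M S f \<in> sets M"
    using assms f(1) by (intro error_set_measurable) (auto dest: range_subsetD)
  have "error_set M T g \<subseteq> error_set M S f \<union> N"
  proof
    fix x assume x: "x \<in> error_set M T g"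
    define y where "y = (SOME y. y \<in> space M - N \<and> pattern T y = pattern T x)"
    have "x \<in> error_set M S f" if "x \<notin> N"
    proof -
      have "x \<in> space M - N" using x that by (auto simp: error_set_def)
      moreover from this have "y \<in> space M - N \<and> pattern T y = pattern T x"
        unfolding y_def by (intro someI_ex[where P="\<lambda>y. y \<in> space M - N \<and> pattern T y = pattern T x"]) auto
      ultimately have "pattern S x = pattern S y"
        using refine by metis
      then show ?thesis
        using x by (auto simp: error_set_def g_def y_def)
    qed
    then show "x \<in> error_set M S f \<union> N" by auto
  qed
  then have "prob (error_set M T g) \<le> prob (error_set M S f \<union> N)"
    using S assms by (intro finite_measure_mono) auto
  also have "\<dots> \<le> \<eta>"
    using S assms f by (simp add: measure_Un_null_set)
  finally have "prob (error_set M T g) \<le> \<eta>" .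
  moreover have "range g \<subseteq> \<alpha>" using f by (auto simp: g_def)
  ultimately show ?thesis by (auto simp: approximable_def)
qed

lemma approximable_superset:
  assumes "finite T" "T \<subseteq> sets M" "S \<subseteq> T" "\<alpha> \<subseteq> sets M" "approximable M \<alpha> S \<eta>"
  shows "approximable M \<alpha> T \<eta>"
proof (rule approximable_refine[where N="{}" and S=S])
  fix x y assume "pattern T x = pattern T y"
  moreover have "pattern S z = pattern T z \<inter> S" for z
    using assms by (auto simp: pattern_def)
  ultimately show "pattern S x = pattern S y" by simp
qed (use assms finite_subset in auto)

text \<open>Guesses compose: where \<open>g\<close> is right, the \<beta>-pattern is the singleton
  of the guessed atom, so \<open>f\<close> can be evaluated there, and the two error sets together
  contain every failure.\<close>

lemma approximable_trans:
  assumes "is_partition M r \<alpha>" "is_partition M s \<beta>" "finite S" "S \<subseteq> sets M"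
    and "approximable M \<alpha> \<beta> \<eta>" "approximable M \<beta> S \<theta>"
  shows "approximable M \<alpha> S (\<eta> + \<theta>)"
proof -
  note \<alpha> = is_partitionD[OF assms(1)] and \<beta> = is_partitionD[OF assms(2)]
  from assms obtain f g where f: "range f \<subseteq> \<alpha>" "prob (error_set M \<beta> f) \<le> \<eta>"
    and g: "range g \<subseteq> \<beta>" "prob (error_set M S g) \<le> \<theta>"
    by (auto simp: approximable_def)
  have m: "error_set M \<beta> f \<in> sets M" "error_set M S g \<in> sets M"
    using error_set_measurable assms f g \<alpha> \<beta> by (meson subset_trans)+
  have "error_set M S (\<lambda>T. f {g T}) \<subseteq> error_set M \<beta> f \<union> error_set M S g"
  proof
    fix x assume x: "x \<in> error_set M S (\<lambda>T. f {g T})"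
    show "x \<in> error_set M \<beta> f \<union> error_set M S g"
    proof (cases "x \<in> g (pattern S x)")
      case True
      then have "pattern \<beta> x = {g (pattern S x)}"
        using g \<beta> by (intro pattern_partition) auto
      then show ?thesis using x by (auto simp: error_set_def)
    qed (use x in \<open>auto simp: error_set_def\<close>)
  qed
  then have "prob (error_set M S (\<lambda>T. f {g T})) \<le> prob (error_set M \<beta> f \<union> error_set M S g)"
    using m by (intro finite_measure_mono) auto
  also have "\<dots> \<le> prob (error_set M \<beta> f) + prob (error_set M S g)"
    using m by (intro measure_Un_le)
  also have "\<dots> \<le> \<eta> + \<theta>" using f g by simp
  finally have "prob (error_set M S (\<lambda>T. f {g T})) \<le> \<eta> + \<theta>" .
  then show ?thesis
    unfolding approximable_def using f by (intro exI[of _ "\<lambda>T. f {g T}"]) auto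
qed

lemma approximable_self:
  assumes "is_partition M r \<alpha>"
  shows "approximable M \<alpha> \<alpha> 0"
proof -
  note \<alpha> = is_partitionD[OF assms] and null = is_partition_null[OF assms]
  obtain A0 where A0: "A0 \<in> \<alpha>" using is_partition_nonempty[OF assms] by auto
  \<comment> \<open>On the union of \<alpha> the pattern is a singleton and names the atom; the
    default \<open>A0\<close> is met only on the null set that \<alpha> misses.\<close>
  define f where "f U = (if \<exists>A\<in>\<alpha>. U = {A} then THE A. U = {A} else A0)" for U
  have f: "range f \<subseteq> \<alpha>" using A0 by (auto simp: f_def)
  have "error_set M \<alpha> f \<subseteq> space M - \<Union>\<alpha>"
    using pattern_partition[OF \<alpha>(4)] by (auto simp: error_set_def f_def)
  then have "prob (error_set M \<alpha> f) \<le> prob (space M - \<Union>\<alpha>)"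
    using null by (intro finite_measure_mono) auto
  then show ?thesis
    using f \<alpha>(6) by (auto simp: approximable_def)
qed

text \<open>Off a null set, an atom \<open>B\<close> in \<open>\<gamma> A\<close> lies inside
  \<open>A\<close>, so the atom of \<beta> containing a point reveals its atom of \<alpha>. This
  shows later that partitions separated by non-approximability are not identified mod 0.\<close>

lemma approximable_equiv:
  assumes "is_partition M r \<alpha>" "is_partition M s \<beta>" "partition_equiv M \<alpha> \<beta>"
  shows "approximable M \<alpha> \<beta> 0"
proof -
  note \<alpha> = is_partitionD[OF assms(1)] and \<beta> = is_partitionD[OF assms(2)]
  note null = is_partition_null[OF assms(1)] is_partition_null[OF assms(2)]
  obtain A0 where A0: "A0 \<in> \<alpha>" using is_partition_nonempty[OF assms(1)] by auto
  have "\<forall>A\<in>\<alpha>. \<exists>\<gamma>\<subseteq>\<beta>. prob ((A - \<Union>\<gamma>) \<union> (\<Union>\<gamma> - A)) = 0"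
    using assms(3) by (auto simp: partition_equiv_def union_mod0_def)
  then obtain \<gamma> where \<gamma>: "\<And>A. A \<in> \<alpha> \<Longrightarrow> \<gamma> A \<subseteq> \<beta>"
    "\<And>A. A \<in> \<alpha> \<Longrightarrow> prob ((A - \<Union>(\<gamma> A)) \<union> (\<Union>(\<gamma> A) - A)) = 0"
    by metis
  define Z where "Z A = (A - \<Union>(\<gamma> A)) \<union> (\<Union>(\<gamma> A) - A)" for A
  have Z: "Z A \<in> null_sets M" if "A \<in> \<alpha>" for A
  proof -
    have "\<Union>(\<gamma> A) \<in> sets M"
      using \<gamma>(1)[OF that] \<beta> finite_subset by (intro sets.finite_Union) auto
    then have "Z A \<in> sets M" unfolding Z_def using that \<alpha> by auto
    then show ?thesis using \<gamma>(2)[OF that]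
      by (auto simp: null_sets_def emeasure_eq_measure Z_def)
  qed
  \<comment> \<open>Two atoms of \<alpha> can claim the same \<open>B\<close> only if
    \<open>B\<close> is null. Any choice is right: a point of \<open>B\<close> outside
    \<open>Z A\<close> lies in \<open>A\<close> whenever \<open>B\<close> belongs to
    \<open>\<gamma> A\<close>.\<close>
  define f where "f U = (if \<exists>A\<in>\<alpha>. \<exists>B\<in>\<gamma> A. U = {B} then SOME A. A \<in> \<alpha> \<and> (\<exists>B\<in>\<gamma> A. U = {B}) else A0)" for U
  have f1: "f U \<in> \<alpha> \<and> (\<exists>B\<in>\<gamma> (f U). U = {B})" if "\<exists>A\<in>\<alpha>. \<exists>B\<in>\<gamma> A. U = {B}" for U
  proof -
    have "\<exists>A. A \<in> \<alpha> \<and> (\<exists>B\<in>\<gamma> A. U = {B})" using that by blast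
    from someI_ex[OF this] that show ?thesis by (simp add: f_def)
  qed
  have f: "range f \<subseteq> \<alpha>"
  proof
    fix A assume "A \<in> range f"
    then obtain U where "A = f U" by auto
    then show "A \<in> \<alpha>" using f1[of U] A0 by (cases "\<exists>A\<in>\<alpha>. \<exists>B\<in>\<gamma> A. U = {B}") (auto simp: f_def)
  qed
  let ?N = "(space M - \<Union>\<alpha>) \<union> (\<Union>A\<in>\<alpha>. Z A)"
  have "error_set M \<beta> f \<subseteq> ?N"
  proof
    fix x assume x: "x \<in> error_set M \<beta> f"
    show "x \<in> ?N"
    proof (rule ccontr)
      assume nx: "x \<notin> ?N"
      then obtain A where A: "A \<in> \<alpha>" "x \<in> A" using x by (auto simp: error_set_def)
      then obtain B where B: "B \<in> \<gamma> A" "x \<in> B" using nx by (auto simp: Z_def)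
      then have p: "pattern \<beta> x = {B}"
        using \<gamma>(1) A \<beta> by (intro pattern_partition) auto
      have "f {B} \<in> \<alpha> \<and> (\<exists>B'\<in>\<gamma> (f {B}). {B} = {B'})" using A B by (intro f1) auto
      then have "f {B} \<in> \<alpha>" "B \<in> \<gamma> (f {B})" by auto
      then have "x \<in> f {B}" using nx B by (auto simp: Z_def)
      then show False using x p by (auto simp: error_set_def)
    qed
  qed
  moreover have N: "?N \<in> null_sets M"
    using null Z \<alpha>(1) by (intro null_sets.Un null_sets.finite_UN) auto
  ultimately have "prob (error_set M \<beta> f) \<le> prob ?N"
    by (intro finite_measure_mono) auto
  also have "\<dots> = 0" using N by (rule measure_eq_0_null_sets)
  finally show ?thesis
    using f by (auto simp: approximable_def)
qed

end

section \<open>Entropy and approximation\<close>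

lemma plogp_nonneg: "0 \<le> x \<Longrightarrow> x \<le> 1 \<Longrightarrow> 0 \<le> - plogp x"
  by (auto simp: plogp_def mult_nonneg_nonpos)

lemma plogp_le: "0 \<le> x \<Longrightarrow> x \<le> 1 \<Longrightarrow> - plogp x \<le> 1 - x"
proof -
  assume x: "0 \<le> x" "x \<le> 1"
  show ?thesis
  proof (cases "x = 0")
    case False
    then have "ln (1 / x) \<le> 1 / x - 1" using x by (intro ln_le_minus_one) auto
    then have "x * ln (1 / x) \<le> x * (1 / x - 1)" using x by (intro mult_left_mono) auto
    moreover have "x * (1 / x - 1) = 1 - x" using False by (simp add: field_simps)
    ultimately show ?thesis using x False by (simp add: plogp_def ln_div)
  qed (auto simp: plogp_def)
qed

text \<open>The concave function -x ln x lies below its tangent at \<open>s\<close>, which is s - x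
  - x ln s. The free parameter \<open>s\<close> trades the constant term against the slope and
  yields a bound linear in \<open>x\<close>.\<close>

lemma plogp_tangent:
  assumes "0 \<le> x" "0 < s"
  shows "- plogp x \<le> s + \<bar>ln s\<bar> * x"
proof (cases "x = 0")
  case False
  then have "ln (s / x) \<le> s / x - 1" using assms by (intro ln_le_minus_one) auto
  then have "x * ln (s / x) \<le> x * (s / x - 1)" using assms by (intro mult_left_mono) auto
  moreover have "x * (s / x - 1) = s - x" using False by (simp add: field_simps)
  ultimately have "x * (ln s - ln x) \<le> s - x" using assms False by (simp add: ln_div)
  then have "- (x * ln x) \<le> s - x - x * ln s" by (simp add: algebra_simps)
  moreover have "- (x * ln s) \<le> x * \<bar>ln s\<bar>"
    using assms by (metis abs_ge_minus_self mult_left_mono mult_minus_right)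
  ultimately show ?thesis using assms False unfolding plogp_def by (simp add: mult.commute)
qed (use assms in \<open>auto simp: plogp_def\<close>)

lemma plogp_mult: "0 \<le> x \<Longrightarrow> 0 \<le> y \<Longrightarrow> plogp (x * y) = x * plogp y + y * plogp x"
  by (auto simp: plogp_def ln_mult algebra_simps)

text \<open>An element of maximal weight m works: the entropy is at least -ln m, and -ln m is at
  least 1 - m. So small entropy means that one guess is nearly always right.\<close>

lemma finite_entropy_ge:
  fixes p :: "'b \<Rightarrow> real"
  assumes "finite A" "\<And>a. a \<in> A \<Longrightarrow> 0 \<le> p a" "sum p A = 1"
  obtains a where "a \<in> A" "1 - p a \<le> (\<Sum>a\<in>A. - plogp (p a))"
proof -
  have ne: "A \<noteq> {}" using assms by auto
  define m where "m = Max (p ` A)"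
  have m: "p a \<le> m" if "a \<in> A" for a
    unfolding m_def using that assms by auto
  have "m \<in> p ` A"
    unfolding m_def using ne assms(1) by (intro Max_in) auto
  then obtain a where a: "a \<in> A" "p a = m" by blast
  have "m > 0"
  proof (rule ccontr)
    assume "\<not> m > 0"
    then have "sum p A \<le> 0" using m by (intro sum_nonpos) (meson linorder_not_le order_trans)
    then show False using assms by simp
  qed
  have "1 - p a \<le> - ln m"
    using ln_le_minus_one[OF \<open>m > 0\<close>] a by simp
  also have "\<dots> = (\<Sum>a\<in>A. p a * (- ln m))"
    unfolding sum_distrib_right[symmetric] assms(3) by simp
  also have "\<dots> \<le> (\<Sum>a\<in>A. - plogp (p a))"
  proof (rule sum_mono)
    fix b assume b: "b \<in> A"
    show "p b * (- ln m) \<le> - plogp (p b)"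
    proof (cases "p b = 0")
      case False
      then have "p b > 0" using assms b by force
      then have "ln (p b) \<le> ln m" using m[OF b] by simp
      then have "p b * ln (p b) \<le> p b * ln m" using \<open>p b > 0\<close> by simp
      then show ?thesis using False by (simp add: plogp_def)
    qed (simp add: plogp_def)
  qed
  finally show ?thesis using that a by blast
qed

context prob_space
begin

section \<open>Conditional entropy against guessing error\<close>

lemma cond_prob_bounds:
  assumes "B \<in> sets M"
  shows "0 \<le> cond_prob M A B" "cond_prob M A B \<le> 1"
  using finite_measure_mono[of "A \<inter> B" B] assms by (auto simp: cond_prob_def divide_simps)

lemma cond_entropy_part_nonneg:
  assumes "\<beta> \<subseteq> sets M"
  shows "0 \<le> cond_entropy_part M \<alpha> \<beta>"
  unfolding cond_entropy_part_def
  using assms cond_prob_bounds by (intro sum_nonneg mult_nonneg_nonneg plogp_nonneg) auto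

lemma prob_sum_partition:
  assumes "is_partition M r \<alpha>" "B \<in> sets M"
  shows "(\<Sum>A\<in>\<alpha>. prob (A \<inter> B)) = prob B"
proof -
  note \<alpha> = is_partitionD[OF assms(1)]
  have "(\<Sum>A\<in>\<alpha>. prob (A \<inter> B)) = prob (\<Union>A\<in>\<alpha>. A \<inter> B)"
    using \<alpha> assms by (intro finite_measure_finite_Union[symmetric])
      (auto simp: disjoint_family_on_def disjoint_def)
  also have "\<dots> = prob ((\<Union>A\<in>\<alpha>. A \<inter> B) \<union> (space M - \<Union>\<alpha>))"
    using \<alpha> assms by (intro measure_Un_null_set[symmetric] is_partition_null[OF assms(1)] sets.finite_UN) auto
  also have "\<dots> = prob (((\<Union>A\<in>\<alpha>. A \<inter> B) \<union> (space M - \<Union>\<alpha>)) \<inter> (B \<union> (space M - \<Union>\<alpha>)))"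
    by (rule arg_cong[where f=prob]) auto
  also have "\<dots> = prob (B \<union> (space M - \<Union>\<alpha>))"
    using sets.sets_into_space[OF assms(2)] by (intro arg_cong[where f=prob]) auto
  also have "\<dots> = prob B"
    using assms(2) by (intro measure_Un_null_set is_partition_null[OF assms(1)])
  finally show ?thesis .
qed

lemma cond_prob_sum_partition:
  assumes "is_partition M r \<alpha>" "B \<in> sets M" "prob B > 0"
  shows "(\<Sum>A\<in>\<alpha>. cond_prob M A B) = 1"
  using prob_sum_partition[OF assms(1,2)] assms(3)
  by (simp add: cond_prob_def flip: sum_divide_distrib)

text \<open>This is the error made on \<open>B\<close> by guessing \<open>A\<close>. For a null
  \<open>B\<close>, where \<open>cond_prob\<close> is 0 by convention, both sides vanish.\<close>

lemma prob_Diff_cond_prob: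
  assumes "A \<in> sets M" "B \<in> sets M"
  shows "prob (B - A) = prob B * (1 - cond_prob M A B)"
proof -
  have "prob (B - A) = prob B - prob (B \<inter> A)" using assms by (simp add: finite_measure_Diff')
  moreover have "prob B = 0 \<Longrightarrow> prob (A \<inter> B) = 0"
    using finite_measure_mono[of "A \<inter> B" B] assms by (simp add: measure_le_0_iff)
  ultimately show ?thesis
    by (auto simp: cond_prob_def zero_less_measure_iff algebra_simps Int_commute)
qed

text \<open>On each atom \<open>B\<close> of \<beta> guess an atom of \<alpha> of largest
  conditional probability. By \<open>finite_entropy_ge\<close> the error on \<open>B\<close> is at
  most the contribution of \<open>B\<close> to the conditional entropy, and these errors add
  up.\<close>

lemma approximable_cond_entropy:
  assumes "is_partition M r \<alpha>" "is_partition M s \<beta>"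
  shows "approximable M \<alpha> \<beta> (cond_entropy_part M \<alpha> \<beta>)"
proof -
  note \<alpha> = is_partitionD[OF assms(1)] and \<beta> = is_partitionD[OF assms(2)]
  obtain A0 where A0: "A0 \<in> \<alpha>" using is_partition_nonempty[OF assms(1)] by auto
  have "\<exists>A\<in>\<alpha>. prob (B - A) \<le> prob B * (\<Sum>A\<in>\<alpha>. - plogp (cond_prob M A B))" if "B \<in> \<beta>" for B
  proof (cases "prob B > 0")
    case True
    have B: "B \<in> sets M" using that \<beta> by auto
    obtain A where A: "A \<in> \<alpha>" "1 - cond_prob M A B \<le> (\<Sum>A\<in>\<alpha>. - plogp (cond_prob M A B))"
      using finite_entropy_ge[OF \<alpha>(1), of "\<lambda>A. cond_prob M A B"]
        cond_prob_sum_partition[OF assms(1) B True] cond_prob_bounds[OF B] by blast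
    have "prob (B - A) = prob B * (1 - cond_prob M A B)"
      using A \<alpha> B by (intro prob_Diff_cond_prob) auto
    also have "\<dots> \<le> prob B * (\<Sum>A\<in>\<alpha>. - plogp (cond_prob M A B))"
      using A by (intro mult_left_mono) auto
    finally show ?thesis using A by blast
  next
    case False
    then have "prob B = 0" by (simp add: zero_less_measure_iff)
    moreover have "prob (B - A0) \<le> prob B"
      using that \<beta> by (intro finite_measure_mono) auto
    ultimately show ?thesis using A0 by (intro bexI[of _ A0]) auto
  qed
  then obtain F where F: "\<And>B. B \<in> \<beta> \<Longrightarrow> F B \<in> \<alpha>"
    "\<And>B. B \<in> \<beta> \<Longrightarrow> prob (B - F B) \<le> prob B * (\<Sum>A\<in>\<alpha>. - plogp (cond_prob M A B))"
    by metis
  define f where "f U = (if \<exists>B\<in>\<beta>. U = {B} then F (the_elem U) else A0)" for U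
  have f: "range f \<subseteq> \<alpha>" using A0 F by (auto simp: f_def)
  have sub: "error_set M \<beta> f \<subseteq> (\<Union>B\<in>\<beta>. B - F B) \<union> (space M - \<Union>\<beta>)"
    using pattern_partition[OF \<beta>(4)] by (auto simp: error_set_def f_def)
  have m: "(\<Union>B\<in>\<beta>. B - F B) \<in> sets M" "(\<lambda>B. B - F B) ` \<beta> \<subseteq> sets M"
  proof -
    have "B - F B \<in> sets M" if "B \<in> \<beta>" for B
      using F(1)[OF that] that \<alpha>(3) \<beta>(3) by auto
    then show "(\<lambda>B. B - F B) ` \<beta> \<subseteq> sets M" "(\<Union>B\<in>\<beta>. B - F B) \<in> sets M"
      using \<beta>(1) by auto
  qed
  have "prob (error_set M \<beta> f) \<le> prob ((\<Union>B\<in>\<beta>. B - F B) \<union> (space M - \<Union>\<beta>))"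
    using m sub is_partition_null[OF assms(2)] by (intro finite_measure_mono) auto
  also have "\<dots> = prob (\<Union>B\<in>\<beta>. B - F B)"
    using m by (intro measure_Un_null_set is_partition_null[OF assms(2)])
  also have "\<dots> \<le> (\<Sum>B\<in>\<beta>. prob (B - F B))"
    using m \<beta> by (intro finite_measure_subadditive_finite)
  also have "\<dots> \<le> cond_entropy_part M \<alpha> \<beta>"
    unfolding cond_entropy_part_def using F by (intro sum_mono) auto
  finally show ?thesis
    using f by (auto simp: approximable_def)
qed

text \<open>A linear form of Fano's inequality. On each \<open>B\<close> the guessed atom is split
  off and bounded by \<open>plogp_le\<close>; the others are bounded by the tangent at
  \<open>s\<close>, and their conditional probabilities sum to the conditional error. Weighting by
  the measure of \<open>B\<close> turns these into the total error.\<close>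

lemma cond_entropy_le_approximable:
  assumes "is_partition M r \<alpha>" "is_partition M q \<beta>" "approximable M \<alpha> \<beta> \<eta>" "0 < s"
  shows "cond_entropy_part M \<alpha> \<beta> \<le> (1 + \<bar>ln s\<bar>) * \<eta> + real r * s"
proof -
  note \<alpha> = is_partitionD[OF assms(1)] and \<beta> = is_partitionD[OF assms(2)]
  from assms obtain f where f: "range f \<subseteq> \<alpha>" "prob (error_set M \<beta> f) \<le> \<eta>"
    by (auto simp: approximable_def)
  have m: "(\<lambda>B. B - f {B}) ` \<beta> \<subseteq> sets M" using f \<alpha> \<beta> by auto
  have le: "prob B * (\<Sum>A\<in>\<alpha>. - plogp (cond_prob M A B))
      \<le> (1 + \<bar>ln s\<bar>) * prob (B - f {B}) + real r * s * prob B" if "B \<in> \<beta>" for B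
  proof (cases "prob B > 0")
    case True
    have B: "B \<in> sets M" using that \<beta> by auto
    let ?A = "f {B}" and ?c = "\<lambda>A. cond_prob M A B"
    have A: "?A \<in> \<alpha>" using f by auto
    have sum1: "(\<Sum>A\<in>\<alpha>-{?A}. ?c A) = 1 - ?c ?A"
      using cond_prob_sum_partition[OF assms(1) B True] A \<alpha>(1) by (simp add: sum_diff1)
    have "(\<Sum>A\<in>\<alpha>. - plogp (?c A)) = - plogp (?c ?A) + (\<Sum>A\<in>\<alpha>-{?A}. - plogp (?c A))"
      using A \<alpha>(1) by (simp add: sum.remove)
    also have "\<dots> \<le> (1 - ?c ?A) + (\<Sum>A\<in>\<alpha>-{?A}. s + \<bar>ln s\<bar> * ?c A)"
      using cond_prob_bounds[OF B] assms(4) by (intro add_mono sum_mono plogp_le plogp_tangent)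
    also have "\<dots> = (1 + \<bar>ln s\<bar>) * (1 - ?c ?A) + real (card (\<alpha> - {?A})) * s"
      by (simp add: sum.distrib sum1 algebra_simps flip: sum_distrib_left)
    also have "\<dots> \<le> (1 + \<bar>ln s\<bar>) * (1 - ?c ?A) + real r * s"
    proof -
      have "card (\<alpha> - {?A}) \<le> r"
        using \<alpha>(1,2) by (meson card_Diff1_le order_trans)
      then show ?thesis using assms(4) by simp
    qed
    finally have "prob B * (\<Sum>A\<in>\<alpha>. - plogp (?c A))
        \<le> prob B * ((1 + \<bar>ln s\<bar>) * (1 - ?c ?A) + real r * s)"
      by (intro mult_left_mono) auto
    also have "\<dots> = (1 + \<bar>ln s\<bar>) * (prob B * (1 - ?c ?A)) + real r * s * prob B"
      by (simp add: algebra_simps)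
    also have "prob B * (1 - ?c ?A) = prob (B - ?A)"
      using A \<alpha> B by (intro prob_Diff_cond_prob[symmetric]) auto
    finally show ?thesis .
  next
    case False
    then have "prob B = 0" by (simp add: zero_less_measure_iff)
    then show ?thesis by simp
  qed
  have "cond_entropy_part M \<alpha> \<beta>
      \<le> (1 + \<bar>ln s\<bar>) * (\<Sum>B\<in>\<beta>. prob (B - f {B})) + real r * s * (\<Sum>B\<in>\<beta>. prob B)"
    unfolding cond_entropy_part_def sum_distrib_left sum.distrib[symmetric]
    by (intro sum_mono) (use le in \<open>simp add: sum_distrib_left\<close>)
  also have "(\<Sum>B\<in>\<beta>. prob B) = 1"
  proof -
    have "(\<Sum>B\<in>\<beta>. prob B) = (\<Sum>B\<in>\<beta>. prob (B \<inter> space M))"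
      using \<beta> sets.Int_space_eq2 by (intro sum.cong) auto
    also have "\<dots> = 1" using prob_sum_partition[OF assms(2), of "space M"] by (simp add: prob_space)
    finally show ?thesis .
  qed
  also have "(\<Sum>B\<in>\<beta>. prob (B - f {B})) = prob (\<Union>B\<in>\<beta>. B - f {B})"
    using m \<beta>(1) disjointD[OF \<beta>(4)] unfolding disjoint_family_on_def
    by (intro finite_measure_finite_Union[symmetric]) (simp_all add: disjoint_family_on_def, blast)
  also have "\<dots> \<le> prob (error_set M \<beta> f)"
  proof (intro finite_measure_mono error_set_measurable)
    show "(\<Union>B\<in>\<beta>. B - f {B}) \<subseteq> error_set M \<beta> f"
    proof
      fix x assume "x \<in> (\<Union>B\<in>\<beta>. B - f {B})"
      then obtain B where B: "B \<in> \<beta>" "x \<in> B" "x \<notin> f {B}" by auto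
      then show "x \<in> error_set M \<beta> f"
        using pattern_partition[OF \<beta>(4) B(1,2)] \<beta>(3) sets.sets_into_space[of B M]
        by (auto simp: error_set_def)
    qed
  qed (use f \<alpha> \<beta> in auto)
  also have "\<dots> \<le> \<eta>" by (rule f)
  finally show ?thesis by (auto simp: mult_left_mono)
qed

text \<open>The tolerance \<eta> depends on \<epsilon> and on the bound \<open>r\<close> for
  \<alpha>, but not on the size \<open>q\<close> of \<beta>. This uniformity is what allows \<beta>
  to be a join with ever more atoms.\<close>

lemma fano:
  assumes "0 < \<epsilon>"
  obtains \<eta> where "0 < \<eta>"
    "\<And>\<alpha> \<beta> q. is_partition M r \<alpha> \<Longrightarrow> is_partition M q \<beta> \<Longrightarrow> approximable M \<alpha> \<beta> \<eta>
      \<Longrightarrow> cond_entropy_part M \<alpha> \<beta> \<le> \<epsilon>"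
proof
  \<comment> \<open>First \<open>s\<close> makes the constant term at most \<epsilon>/2, then \<eta>
    is adapted to the resulting slope; \<open>real r + 1\<close> keeps the denominator
    positive.\<close>
  define s where "s = \<epsilon> / (2 * (real r + 1))"
  define \<eta> where "\<eta> = \<epsilon> / (2 * (1 + \<bar>ln s\<bar>))"
  have s: "s > 0" "real r * s \<le> \<epsilon> / 2" using assms by (auto simp: s_def field_simps)
  show "0 < \<eta>" using assms by (auto simp: \<eta>_def add_pos_nonneg)
  have "1 + \<bar>ln s\<bar> \<noteq> 0" by linarith
  then have "(1 + \<bar>ln s\<bar>) * \<eta> = \<epsilon> / 2" unfolding \<eta>_def by (simp add: divide_simps)
  then show "cond_entropy_part M \<alpha> \<beta> \<le> \<epsilon>"
    if "is_partition M r \<alpha>" "is_partition M q \<beta>" "approximable M \<alpha> \<beta> \<eta>" for \<alpha> \<beta> q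
    using cond_entropy_le_approximable[OF that s(1)] s(2) by linarith
qed

end

section \<open>Joins and maximal pattern entropy\<close>

definition join :: "'a set set \<Rightarrow> 'a set set \<Rightarrow> 'a set set" where
  "join \<alpha> \<beta> = (\<lambda>(A, B). A \<inter> B) ` (\<alpha> \<times> \<beta>)"

text \<open>The partition into the atoms of the algebra generated by \<open>S\<close>; subfamilies
  that are the pattern of no point contribute the empty set.\<close>

definition atoms_of :: "'a measure \<Rightarrow> 'a set set \<Rightarrow> 'a set set" where
  "atoms_of M S = (\<lambda>T. {x \<in> space M. pattern S x = T}) ` Pow S"

lemma join_memberI: "A \<in> \<alpha> \<Longrightarrow> B \<in> \<beta> \<Longrightarrow> A \<inter> B \<in> join \<alpha> \<beta>"
  by (auto simp: join_def)

lemma join_left_commute: "join \<alpha> (join \<beta> \<gamma>) = join \<beta> (join \<alpha> \<gamma>)"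
proof -
  have "join \<alpha> (join \<beta> \<gamma>) \<subseteq> join \<beta> (join \<alpha> \<gamma>)" for \<alpha> \<beta> :: "'a set set"
  proof
    fix X assume "X \<in> join \<alpha> (join \<beta> \<gamma>)"
    then obtain A B C where "A \<in> \<alpha>" "B \<in> \<beta>" "C \<in> \<gamma>" "X = A \<inter> (B \<inter> C)"
      by (auto simp: join_def)
    moreover have "A \<inter> (B \<inter> C) = B \<inter> (A \<inter> C)" by auto
    ultimately show "X \<in> join \<beta> (join \<alpha> \<gamma>)" by (auto intro!: join_memberI)
  qed
  then show ?thesis by blast
qed

lemma join_n_0: "join_n M \<alpha>s 0 = {space M}"
  by (simp add: join_n_def)

lemma join_n_Suc: "join_n M \<alpha>s (Suc n) = join (\<alpha>s n) (join_n M \<alpha>s n)"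
proof
  show "join_n M \<alpha>s (Suc n) \<subseteq> join (\<alpha>s n) (join_n M \<alpha>s n)"
  proof
    fix X assume "X \<in> join_n M \<alpha>s (Suc n)"
    then obtain f where f: "X = space M \<inter> (\<Inter>i<Suc n. f i)" "\<forall>i<Suc n. f i \<in> \<alpha>s i"
      by (auto simp: join_n_def)
    then have "X = f n \<inter> (space M \<inter> (\<Inter>i<n. f i))" by (auto simp: lessThan_Suc)
    moreover have "space M \<inter> (\<Inter>i<n. f i) \<in> join_n M \<alpha>s n"
      unfolding join_n_def using f(2) less_SucI by blast
    ultimately show "X \<in> join (\<alpha>s n) (join_n M \<alpha>s n)"
      using f(2) by (auto intro!: join_memberI)
  qed
next
  show "join (\<alpha>s n) (join_n M \<alpha>s n) \<subseteq> join_n M \<alpha>s (Suc n)"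
  proof
    fix X assume "X \<in> join (\<alpha>s n) (join_n M \<alpha>s n)"
    then obtain A f where f: "A \<in> \<alpha>s n" "X = A \<inter> (space M \<inter> (\<Inter>i<n. f i))" "\<forall>i<n. f i \<in> \<alpha>s i"
      by (auto simp: join_n_def join_def)
    then have "X = space M \<inter> (\<Inter>i<Suc n. (f(n := A)) i)"
      by (auto simp: lessThan_Suc)
    moreover have "\<forall>i<Suc n. (f(n := A)) i \<in> \<alpha>s i" using f by (auto simp: less_Suc_eq)
    ultimately show "X \<in> join_n M \<alpha>s (Suc n)" unfolding join_n_def by blast
  qed
qed

text \<open>Greedy choice in abstract form, where each new term is constrained only by the finite
  set of its predecessors. It is applied to partitions and, in the L2 argument, to single
  atoms.\<close>

lemma dependent_sequence:
  fixes P :: "'b set \<Rightarrow> 'b \<Rightarrow> bool"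
  assumes "\<And>F. finite F \<Longrightarrow> F \<subseteq> Z \<Longrightarrow> \<exists>z\<in>Z. P F z"
  obtains a :: "nat \<Rightarrow> 'b" where "\<And>n. a n \<in> Z" "\<And>n. P (a ` {..<n}) (a n)"
proof -
  have "\<exists>a. \<forall>n::nat. a n \<in> Z \<and> P (a ` {..<n}) (a n)"
  proof (rule dependent_wellorder_choice[where P="\<lambda>a n z. z \<in> Z \<and> P (a ` {..<n}) z"])
    fix r :: 'b and f g :: "nat \<Rightarrow> 'b" and x assume "\<And>y. y < x \<Longrightarrow> f y = g y"
    then have "f ` {..<x} = g ` {..<x}" by auto
    then show "(r \<in> Z \<and> P (f ` {..<x}) r) = (r \<in> Z \<and> P (g ` {..<x}) r)" by simp
  next
    fix x and f :: "nat \<Rightarrow> 'b" assume "\<And>y. y < x \<Longrightarrow> f y \<in> Z \<and> P (f ` {..<y}) (f y)"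
    then have "f ` {..<x} \<subseteq> Z" by auto
    then show "\<exists>r. r \<in> Z \<and> P (f ` {..<x}) r" using assms[of "f ` {..<x}"] by auto
  qed
  then show ?thesis using that by blast
qed

context prob_space
begin

lemma is_partition_join:
  assumes "is_partition M r \<alpha>" "is_partition M s \<beta>"
  shows "is_partition M (r * s) (join \<alpha> \<beta>)"
proof -
  note \<alpha> = is_partitionD[OF assms(1)] and \<beta> = is_partitionD[OF assms(2)]
  note null = is_partition_null[OF assms(1)] is_partition_null[OF assms(2)]
  have "card (join \<alpha> \<beta>) \<le> card (\<alpha> \<times> \<beta>)"
    unfolding join_def using \<alpha> \<beta> by (intro card_image_le) auto
  also have "\<dots> \<le> r * s" using \<alpha> \<beta> by (auto simp: card_cartesian_product intro: mult_le_mono)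
  finally have card: "card (join \<alpha> \<beta>) \<le> r * s" .
  have sets: "join \<alpha> \<beta> \<subseteq> sets M" using \<alpha> \<beta> by (auto simp: join_def)
  have disj: "disjoint (join \<alpha> \<beta>)"
  proof (rule disjointI)
    fix X Y assume "X \<in> join \<alpha> \<beta>" "Y \<in> join \<alpha> \<beta>" "X \<noteq> Y"
    then obtain A B A' B' where *: "A \<in> \<alpha>" "B \<in> \<beta>" "A' \<in> \<alpha>" "B' \<in> \<beta>" "X = A \<inter> B" "Y = A' \<inter> B'"
      "A \<noteq> A' \<or> B \<noteq> B'" by (auto simp: join_def)
    then show "X \<inter> Y = {}" using disjointD[OF \<alpha>(4)] disjointD[OF \<beta>(4)] by blast
  qed
  have "space M - \<Union>(join \<alpha> \<beta>) \<subseteq> (space M - \<Union>\<alpha>) \<union> (space M - \<Union>\<beta>)"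
    by (auto simp: join_def)
  moreover have "(space M - \<Union>\<alpha>) \<union> (space M - \<Union>\<beta>) \<in> null_sets M"
    using null by auto
  moreover have "space M - \<Union>(join \<alpha> \<beta>) \<in> sets M"
    using \<alpha> \<beta> sets by (auto simp: join_def intro!: sets.finite_Union)
  ultimately have "space M - \<Union>(join \<alpha> \<beta>) \<in> null_sets M"
    using null_sets_subset by blast
  then show ?thesis
    using card sets disj \<alpha> \<beta> by (auto simp: is_partition_def measure_eq_0_null_sets join_def)
qed

lemma is_partition_join_n:
  assumes "\<And>i. i < n \<Longrightarrow> is_partition M r (\<alpha>s i)"
  shows "is_partition M (r ^ n) (join_n M \<alpha>s n)"
  using assms
proof (induction n)
  case 0
  then show ?case by (auto simp: join_n_0 is_partition_def)
next
  case (Suc n)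
  then show ?case
    using is_partition_join[of r "\<alpha>s n" "r ^ n" "join_n M \<alpha>s n"] by (simp add: join_n_Suc)
qed

lemma is_partition_atoms_of:
  assumes "finite S" "S \<subseteq> sets M"
  shows "is_partition M (2 ^ card S) (atoms_of M S)"
proof -
  have "card (atoms_of M S) \<le> card (Pow S)"
    unfolding atoms_of_def using assms by (intro card_image_le) auto
  moreover have "\<Union>(atoms_of M S) = space M"
    using pattern_in_Pow by (fastforce simp: atoms_of_def)
  moreover have "atoms_of M S \<subseteq> sets M"
    using pattern_measurable[OF assms] by (auto simp: atoms_of_def)
  moreover have "disjoint (atoms_of M S)" by (auto simp: atoms_of_def disjoint_def)
  ultimately show ?thesis
    using assms by (auto simp: is_partition_def card_Pow atoms_of_def)
qed

section \<open>Chain rule and growth of the entropy of joins\<close>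

lemma entropy_part_nonneg: "0 \<le> entropy_part M \<alpha>"
  unfolding entropy_part_def by (intro sum_nonneg plogp_nonneg) auto

lemma entropy_part_le:
  assumes "is_partition M r \<alpha>"
  shows "entropy_part M \<alpha> \<le> real r"
proof -
  have "- plogp (prob A) \<le> 1" for A
    using plogp_le[of "prob A"] measure_nonneg[of M A] prob_le_1[of A] by linarith
  then have "entropy_part M \<alpha> \<le> (\<Sum>A\<in>\<alpha>. 1)"
    unfolding entropy_part_def by (intro sum_mono)
  then show ?thesis using is_partitionD(2)[OF assms] by simp
qed

text \<open>The chain rule. Distinct pairs of atoms with the same intersection have empty
  intersection, whose term vanishes, so the sum may run over pairs; then \<open>plogp_mult\<close>
  splits each term.\<close>

lemma entropy_part_join:
  assumes "is_partition M r \<alpha>" "is_partition M s \<beta>"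
  shows "entropy_part M (join \<alpha> \<beta>) = entropy_part M \<beta> + cond_entropy_part M \<alpha> \<beta>"
proof -
  note \<alpha> = is_partitionD[OF assms(1)] and \<beta> = is_partitionD[OF assms(2)]
  have "entropy_part M (join \<alpha> \<beta>) = (\<Sum>(A, B)\<in>\<alpha> \<times> \<beta>. - plogp (prob (A \<inter> B)))"
    unfolding entropy_part_def join_def
  proof (subst sum.reindex_nontrivial)
    fix x y assume *: "x \<in> \<alpha> \<times> \<beta>" "y \<in> \<alpha> \<times> \<beta>" "x \<noteq> y"
      "(case x of (A, B) \<Rightarrow> A \<inter> B) = (case y of (A, B) \<Rightarrow> A \<inter> B)"
    obtain A B A' B' where xy: "x = (A, B)" "y = (A', B')" by (metis surj_pair)
    then have "A \<inter> A' = {} \<or> B \<inter> B' = {}"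
      using * disjointD[OF \<alpha>(4), of A A'] disjointD[OF \<beta>(4), of B B'] by auto
    then have "A \<inter> B = {}" using * xy by auto
    then show "- plogp (prob (case x of (A, B) \<Rightarrow> A \<inter> B)) = 0" using xy by (simp add: plogp_def)
  qed (use \<alpha> \<beta> in \<open>auto intro!: sum.cong\<close>)
  also have "\<dots> = (\<Sum>B\<in>\<beta>. \<Sum>A\<in>\<alpha>. - plogp (prob (A \<inter> B)))"
    by (simp add: sum.cartesian_product[symmetric] sum.swap[of _ \<beta>])
  also have "\<dots> = (\<Sum>B\<in>\<beta>. - plogp (prob B) + prob B * (\<Sum>A\<in>\<alpha>. - plogp (cond_prob M A B)))"
  proof (intro sum.cong refl)
    fix B assume "B \<in> \<beta>"
    then have B: "B \<in> sets M" using \<beta> by auto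
    show "(\<Sum>A\<in>\<alpha>. - plogp (prob (A \<inter> B)))
        = - plogp (prob B) + prob B * (\<Sum>A\<in>\<alpha>. - plogp (cond_prob M A B))"
    proof (cases "prob B > 0")
      case True
      have "- plogp (prob (A \<inter> B))
          = cond_prob M A B * (- plogp (prob B)) + prob B * (- plogp (cond_prob M A B))" for A
      proof -
        have "prob (A \<inter> B) = prob B * cond_prob M A B" using True by (simp add: cond_prob_def)
        then show ?thesis
          using plogp_mult[of "prob B" "cond_prob M A B"] cond_prob_bounds[OF B] by simp
      qed
      then have "(\<Sum>A\<in>\<alpha>. - plogp (prob (A \<inter> B)))
          = (\<Sum>A\<in>\<alpha>. cond_prob M A B) * (- plogp (prob B))
            + prob B * (\<Sum>A\<in>\<alpha>. - plogp (cond_prob M A B))"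
        unfolding sum_distrib_right sum_distrib_left sum.distrib[symmetric] by (intro sum.cong) auto
      then show ?thesis using cond_prob_sum_partition[OF assms(1) B True] by simp
    next
      case False
      then have "prob B = 0" by (simp add: zero_less_measure_iff)
      moreover from this have "prob (A \<inter> B) = 0" for A
        using finite_measure_mono[of "A \<inter> B" B] B by (simp add: measure_le_0_iff)
      ultimately show ?thesis by (simp add: plogp_def)
    qed
  qed
  also have "\<dots> = entropy_part M \<beta> + cond_entropy_part M \<alpha> \<beta>"
    unfolding sum.distrib entropy_part_def cond_entropy_part_def ..
  finally show ?thesis .
qed

text \<open>The member of the join containing \<open>x\<close> also contains \<open>y\<close>, so
  both lie in one atom of the algebra generated by \<open>S\<close>, where the
  \<open>S\<close>-pattern is constant.\<close>

lemma pattern_atoms_of: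
  assumes "pattern (join (atoms_of M S) \<gamma>) x = pattern (join (atoms_of M S) \<gamma>) y"
    and "x \<in> \<Union>(join (atoms_of M S) \<gamma>)"
  shows "pattern S x = pattern S y"
proof -
  from assms(2) obtain T C where *: "T \<in> atoms_of M S" "C \<in> \<gamma>" "x \<in> T \<inter> C"
    by (auto simp: join_def)
  then have "T \<inter> C \<in> pattern (join (atoms_of M S) \<gamma>) x"
    by (auto simp: pattern_def intro: join_memberI)
  then have "T \<inter> C \<in> pattern (join (atoms_of M S) \<gamma>) y" using assms(1) by simp
  then have "y \<in> T" unfolding pattern_def by blast
  then show ?thesis using * by (auto simp: atoms_of_def)
qed

text \<open>Starting the join with the atoms of \<open>S\<close> costs at most
  \<open>2 ^ card S\<close>. Every later join refines these atoms, so each \<alpha> stays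
  \<eta>-approximable from it and adds at most \<epsilon> by the chain rule.\<close>

lemma entropy_join_n_le:
  assumes S: "finite S" "S \<subseteq> sets M"
    and \<alpha>s: "\<And>i. i < n \<Longrightarrow> is_partition M r (\<alpha>s i)" "\<And>i. i < n \<Longrightarrow> approximable M (\<alpha>s i) S \<eta>"
    and \<eta>: "\<And>\<alpha> \<beta> q. is_partition M r \<alpha> \<Longrightarrow> is_partition M q \<beta> \<Longrightarrow> approximable M \<alpha> \<beta> \<eta>
      \<Longrightarrow> cond_entropy_part M \<alpha> \<beta> \<le> \<epsilon>"
  shows "entropy_part M (join_n M \<alpha>s n) \<le> 2 ^ card S + real n * \<epsilon>"
proof -
  let ?P = "atoms_of M S"
  note P = is_partition_atoms_of[OF S]
  have *: "entropy_part M (join ?P (join_n M \<alpha>s m)) \<le> 2 ^ card S + real m * \<epsilon>" if "m \<le> n" for m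
    using that
  proof (induction m)
    case 0
    have "is_partition M 1 {space M}" by (auto simp: is_partition_def)
    from entropy_part_le[OF is_partition_join[OF P this]] show ?case by (simp add: join_n_0)
  next
    case (Suc m)
    let ?J = "join ?P (join_n M \<alpha>s m)"
    have J: "is_partition M (2 ^ card S * r ^ m) ?J"
      using Suc.prems \<alpha>s by (intro is_partition_join P is_partition_join_n) auto
    have \<alpha>: "is_partition M r (\<alpha>s m)" "approximable M (\<alpha>s m) S \<eta>" using Suc.prems \<alpha>s by auto
    have "approximable M (\<alpha>s m) ?J \<eta>"
    proof (rule approximable_refine[OF S is_partitionD(3)[OF \<alpha>(1)] is_partition_null[OF J] _ \<alpha>(2)])
      fix x y assume "x \<in> space M - (space M - \<Union>?J)" "pattern ?J x = pattern ?J y"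
      moreover from this have "x \<in> \<Union>?J" by simp
      ultimately show "pattern S x = pattern S y"
        using pattern_atoms_of[of S "join_n M \<alpha>s m" x y] by simp
    qed
    then have "cond_entropy_part M (\<alpha>s m) ?J \<le> \<epsilon>" using \<eta> \<alpha>(1) J by blast
    then show ?case
      using Suc entropy_part_join[OF \<alpha>(1) J]
      by (simp add: join_n_Suc join_left_commute[of ?P] algebra_simps)
  qed
  have "is_partition M (r ^ n) (join_n M \<alpha>s n)" using \<alpha>s by (intro is_partition_join_n) auto
  \<comment> \<open>The auxiliary atoms are dropped again: by the chain rule, joining them can only
    have increased the entropy.\<close>
  from entropy_part_join[OF P this] cond_entropy_part_nonneg[of "join_n M \<alpha>s n" ?P]
    is_partitionD(3)[OF this]
  have "entropy_part M (join_n M \<alpha>s n) \<le> entropy_part M (join ?P (join_n M \<alpha>s n))" by simp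
  then show ?thesis using *[of n] by simp
qed

section \<open>Zero maximal pattern entropy and uniform approximability\<close>

lemma max_pattern_P_bounds:
  assumes "K \<subseteq> partitions M r"
  shows "0 \<le> max_pattern_P M K n"
    and "(\<And>i. i < n \<Longrightarrow> \<alpha>s i \<in> K) \<Longrightarrow> entropy_part M (join_n M \<alpha>s n) \<le> max_pattern_P M K n"
proof -
  let ?X = "{0} \<union> {entropy_part M (join_n M \<alpha>s n) | \<alpha>s. \<forall>i<n. \<alpha>s i \<in> K}"
  \<comment> \<open>The crude bound \<open>r ^ n\<close> is enough to make the real
    \<open>Sup\<close> a genuine least upper bound.\<close>
  have "bdd_above ?X"
  proof (rule bdd_aboveI)
    fix x assume "x \<in> ?X"
    then consider "x = 0" | \<alpha>s where "x = entropy_part M (join_n M \<alpha>s n)" "\<forall>i<n. \<alpha>s i \<in> K"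
      by auto
    then show "x \<le> real (r ^ n)"
    proof cases
      case 2
      then have "is_partition M (r ^ n) (join_n M \<alpha>s n)"
        using assms by (intro is_partition_join_n) (auto simp: partitions_def)
      then show ?thesis using entropy_part_le 2 by blast
    qed auto
  qed
  then show "0 \<le> max_pattern_P M K n"
    and "(\<And>i. i < n \<Longrightarrow> \<alpha>s i \<in> K) \<Longrightarrow> entropy_part M (join_n M \<alpha>s n) \<le> max_pattern_P M K n"
    unfolding max_pattern_P_def by (auto intro!: cSup_upper)
qed

text \<open>One family \<open>S\<close> serves all of \<open>K\<close>, so the entropy of n-fold
  joins is at most a constant plus n times a small number; the constant disappears after division by
  n.\<close>

lemma uniformly_approximable_imp_max_pattern_entropy:
  assumes K: "K \<subseteq> partitions M r" and "uniformly_approximable M K"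
  shows "max_pattern_entropy M K = 0"
proof -
  have "(\<lambda>n. max_pattern_P M K n / real n) \<longlonglongrightarrow> 0"
  proof (rule LIMSEQ_I)
    fix e :: real assume "0 < e"
    then obtain \<eta> where "0 < \<eta>" and \<eta>: "\<And>\<alpha> \<beta> q. is_partition M r \<alpha> \<Longrightarrow> is_partition M q \<beta>
      \<Longrightarrow> approximable M \<alpha> \<beta> \<eta> \<Longrightarrow> cond_entropy_part M \<alpha> \<beta> \<le> e / 2"
      using fano[of "e / 2" r] half_gt_zero by blast
    have "\<exists>S. finite S \<and> S \<subseteq> sets M \<and> (\<forall>\<alpha>\<in>K. approximable M \<alpha> S \<eta>)"
      using assms(2) \<open>0 < \<eta>\<close> unfolding uniformly_approximable_def by simp
    then obtain S where S: "finite S" "S \<subseteq> sets M" "\<forall>\<alpha>\<in>K. approximable M \<alpha> S \<eta>"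
      by (elim exE conjE)
    have le: "max_pattern_P M K n \<le> 2 ^ card S + real n * (e / 2)" for n
      unfolding max_pattern_P_def
    proof (rule cSup_least)
      fix x assume "x \<in> {0} \<union> {entropy_part M (join_n M \<alpha>s n) | \<alpha>s. \<forall>i<n. \<alpha>s i \<in> K}"
      then consider "x = 0" | \<alpha>s where "x = entropy_part M (join_n M \<alpha>s n)" "\<forall>i<n. \<alpha>s i \<in> K"
        by auto
      then show "x \<le> 2 ^ card S + real n * (e / 2)"
      proof cases
        case 2
        then have "\<And>i. i < n \<Longrightarrow> is_partition M r (\<alpha>s i)" "\<And>i. i < n \<Longrightarrow> approximable M (\<alpha>s i) S \<eta>"
          using S(3) K by (auto simp: partitions_def)
        from entropy_join_n_le[OF S(1,2) this \<eta>] 2 show ?thesis by simp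
      qed (use \<open>0 < e\<close> in auto)
    qed auto
    obtain N :: nat where N: "2 ^ card S / (e / 2) < real N" using reals_Archimedean2 by blast
    show "\<exists>N. \<forall>n\<ge>N. norm (max_pattern_P M K n / real n - 0) < e"
    proof (intro exI allI impI)
      fix n assume n: "Suc N \<le> n"
      then have "2 ^ card S / (e / 2) < real n" using N by linarith
      then have "2 ^ card S < real n * (e / 2)" using \<open>0 < e\<close> by (simp add: field_simps)
      then have "max_pattern_P M K n < real n * e" using le[of n] by (simp add: field_simps)
      then show "norm (max_pattern_P M K n / real n - 0) < e"
        using n max_pattern_P_bounds(1)[OF K, of n] by (simp add: field_simps)
    qed
  qed
  then have "(\<lambda>n. ereal (max_pattern_P M K n / real n)) \<longlonglongrightarrow> 0"
    by (simp add: zero_ereal_def)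
  then show ?thesis
    unfolding max_pattern_entropy_def by (intro lim_imp_Limsup) auto
qed

text \<open>The union of the partitions chosen so far is itself a finite family, so some member of
  \<open>K\<close> is not approximable from it and is chosen next. The form with the union drives
  entropy growth; the pairwise form, which follows by monotonicity, contradicts convergence and
  bounded complexity.\<close>

lemma not_uniformly_approximable_sequence:
  assumes K: "K \<subseteq> partitions M r" and "\<not> uniformly_approximable M K"
  obtains \<eta> a where "0 < \<eta>" "\<And>n::nat. a n \<in> K"
    "\<And>n. \<not> approximable M (a n) (\<Union>i<n. a i) \<eta>"
    "\<And>m n. m < n \<Longrightarrow> \<not> approximable M (a n) (a m) \<eta>"
proof -
  from assms(2) obtain \<eta> where "0 < \<eta>"
    "\<nexists>S. finite S \<and> S \<subseteq> sets M \<and> (\<forall>\<alpha>\<in>K. approximable M \<alpha> S \<eta>)"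
    unfolding uniformly_approximable_def by meson
  then have \<eta>: "0 < \<eta>"
    "\<And>S. finite S \<Longrightarrow> S \<subseteq> sets M \<Longrightarrow> \<exists>\<alpha>\<in>K. \<not> approximable M \<alpha> S \<eta>"
    by auto
  have part: "is_partition M r \<alpha>" if "\<alpha> \<in> K" for \<alpha> using that K by (auto simp: partitions_def)
  have U: "finite (\<Union>F)" "\<Union>F \<subseteq> sets M" if F: "finite F" "F \<subseteq> K" for F
  proof -
    have "finite \<alpha>" "\<alpha> \<subseteq> sets M" if "\<alpha> \<in> F" for \<alpha>
      using that F(2) is_partitionD(1,3)[OF part] by blast+
    then show "finite (\<Union>F)" "\<Union>F \<subseteq> sets M"
      using finite_Union[OF F(1)] by blast+
  qed
  have "\<exists>z\<in>K. \<not> approximable M z (\<Union>F) \<eta>" if "finite F" "F \<subseteq> K" for F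
    using \<eta>(2)[OF U[OF that]] .
  then obtain a where a: "\<And>n::nat. a n \<in> K" "\<And>n. \<not> approximable M (a n) (\<Union>(a ` {..<n})) \<eta>"
    using dependent_sequence[of K "\<lambda>F z. \<not> approximable M z (\<Union>F) \<eta>"] by blast
  have "\<not> approximable M (a n) (a m) \<eta>" if "m < n" for m n
  proof
    assume *: "approximable M (a n) (a m) \<eta>"
    have F: "finite (a ` {..<n})" "a ` {..<n} \<subseteq> K" using a(1) by auto
    have "a m \<subseteq> \<Union>(a ` {..<n})" using that by auto
    then have "approximable M (a n) (\<Union>(a ` {..<n})) \<eta>"
      using approximable_superset[OF U[OF F] _ is_partitionD(3)[OF part[OF a(1)]] *] by simp
    then show False using a(2)[of n] by contradiction
  qed
  with \<eta>(1) a show ?thesis by (intro that)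
qed

text \<open>Along the greedy sequence each new partition has conditional entropy above \<eta> given
  the join of its predecessors, since otherwise it would be approximable from them. By the chain
  rule the entropy grows linearly, so the upper limit is at least \<eta>.\<close>

lemma max_pattern_entropy_imp_uniformly_approximable:
  assumes K: "K \<subseteq> partitions M r" and "max_pattern_entropy M K = 0"
  shows "uniformly_approximable M K"
proof (rule ccontr)
  assume "\<not> uniformly_approximable M K"
  from not_uniformly_approximable_sequence[OF K this] obtain \<eta> a where \<eta>: "0 < \<eta>"
    and a: "\<And>n::nat. a n \<in> K" "\<And>n. \<not> approximable M (a n) (\<Union>i<n. a i) \<eta>" by metis
  have part: "is_partition M r (a n)" for n using a(1) K by (auto simp: partitions_def)
  have "real n * \<eta> \<le> entropy_part M (join_n M a n)" for n
  proof (induction n)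
    case 0
    then show ?case by (simp add: entropy_part_nonneg)
  next
    case (Suc n)
    let ?J = "join_n M a n" and ?U = "\<Union>i<n. a i"
    have J: "is_partition M (r ^ n) ?J" using part by (intro is_partition_join_n)
    have "\<eta> < cond_entropy_part M (a n) ?J"
    proof (rule ccontr)
      assume "\<not> \<eta> < cond_entropy_part M (a n) ?J"
      then have "approximable M (a n) ?J \<eta>"
        using approximable_cond_entropy[OF part J] approximable_mono by (meson linorder_not_le)
      \<comment> \<open>Members of the join are intersections of earlier atoms, so for points of the
        space the \<open>?U\<close>-pattern determines the \<open>?J\<close>-pattern.\<close>
      then have "approximable M (a n) ?U \<eta>"
      proof (rule approximable_refine[where N="{}" and S="?J", rotated -1])
        fix x y assume xy: "x \<in> space M - {}" "y \<in> space M - {}" "pattern ?U x = pattern ?U y"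
        have U: "x \<in> A \<longleftrightarrow> y \<in> A" if "i < n" "A \<in> a i" for i A
          using xy(3) that by (auto simp: pattern_def)
        have "x \<in> X \<longleftrightarrow> y \<in> X" if "X \<in> ?J" for X
          using that xy U unfolding join_n_def by fastforce
        then show "pattern ?J x = pattern ?J y" by (auto simp: pattern_def)
      qed (use is_partitionD[OF part] is_partitionD[OF J] in auto)
      then show False using a(2) by blast
    qed
    then show ?case
      using Suc entropy_part_join[OF part J] by (simp add: join_n_Suc algebra_simps)
  qed
  then have "real n * \<eta> \<le> max_pattern_P M K n" for n
    using max_pattern_P_bounds(2)[OF K, of n a] a(1) by (meson order_trans)
  then have "ereal \<eta> \<le> ereal (max_pattern_P M K n / real n)" if "n \<ge> 1" for n
    using that by (simp add: field_simps)
  then have "\<forall>\<^sub>F n in sequentially. ereal \<eta> \<le> ereal (max_pattern_P M K n / real n)"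
    by (auto simp: eventually_sequentially)
  then have "ereal \<eta> \<le> max_pattern_entropy M K"
    unfolding max_pattern_entropy_def
    by (intro order_trans[OF Liminf_bounded Liminf_le_Limsup]) auto
  then show False using assms(2) \<eta> by simp
qed

section \<open>The Rokhlin metric\<close>

text \<open>Late terms of a convergent subsequence of the greedy sequence are approximable from the
  limit and conversely, hence from each other through the limit.\<close>

lemma rho_precompact_imp_uniformly_approximable:
  assumes K: "K \<subseteq> partitions M r" and "rho_precompact M r K"
  shows "uniformly_approximable M K"
proof (rule ccontr)
  assume "\<not> uniformly_approximable M K"
  from not_uniformly_approximable_sequence[OF K this] obtain \<eta> a where \<eta>: "0 < \<eta>"
    and a: "\<And>n::nat. a n \<in> K" "\<And>m n. m < n \<Longrightarrow> \<not> approximable M (a n) (a m) \<eta>" by metis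
  from assms(2) a(1) obtain \<sigma> \<beta> where \<sigma>: "strict_mono \<sigma>" "\<beta> \<in> partitions M r"
    "(\<lambda>n. rokhlin M (a (\<sigma> n)) \<beta>) \<longlonglongrightarrow> 0"
    unfolding rho_precompact_def by meson
  have part: "is_partition M r (a n)" for n using a(1) K by (auto simp: partitions_def)
  have \<beta>: "is_partition M r \<beta>" using \<sigma>(2) by (simp add: partitions_def)
  from order_tendstoD(2)[OF \<sigma>(3), of "\<eta> / 2"] \<eta> obtain N
    where N: "\<And>n. n \<ge> N \<Longrightarrow> rokhlin M (a (\<sigma> n)) \<beta> < \<eta> / 2"
    by (auto simp: eventually_sequentially)
  have "approximable M (a (\<sigma> n)) \<beta> (\<eta> / 2)" "approximable M \<beta> (a (\<sigma> n)) (\<eta> / 2)" if "n \<ge> N" for n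
  proof -
    have "0 \<le> cond_entropy_part M (a (\<sigma> n)) \<beta>" "0 \<le> cond_entropy_part M \<beta> (a (\<sigma> n))"
      using is_partitionD(3)[OF part] is_partitionD(3)[OF \<beta>]
      by (auto intro!: cond_entropy_part_nonneg)
    then have "cond_entropy_part M (a (\<sigma> n)) \<beta> \<le> \<eta> / 2" "cond_entropy_part M \<beta> (a (\<sigma> n)) \<le> \<eta> / 2"
      using N[OF that] by (auto simp: rokhlin_def)
    then show "approximable M (a (\<sigma> n)) \<beta> (\<eta> / 2)" "approximable M \<beta> (a (\<sigma> n)) (\<eta> / 2)"
      using approximable_cond_entropy part \<beta> approximable_mono by blast+
  qed
  \<comment> \<open>The direction matters: the greedy choice excludes approximating a later term
    from an earlier one.\<close>
  then have "approximable M (a (\<sigma> (Suc N))) (a (\<sigma> N)) (\<eta> / 2 + \<eta> / 2)"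
    using part \<beta> is_partitionD[OF part] by (intro approximable_trans[of r _ r \<beta>]) auto
  then show False
    using a(2)[of "\<sigma> N" "\<sigma> (Suc N)"] strict_monoD[OF \<sigma>(1), of N "Suc N"] by simp
qed

end

section \<open>Compactness\<close>

definition labelled_atom :: "'a set set \<Rightarrow> ('a set \<Rightarrow> nat) \<Rightarrow> nat \<Rightarrow> 'a set" where
  "labelled_atom \<alpha> e i = \<Union>{A \<in> \<alpha>. e A = i}"

lemma labelled_atom_mem:
  assumes "inj_on e \<alpha>" "A \<in> \<alpha>"
  shows "labelled_atom \<alpha> e (e A) = A"
proof -
  have "{B \<in> \<alpha>. e B = e A} = {A}" using assms by (auto dest: inj_onD)
  then show ?thesis by (simp add: labelled_atom_def)
qed

lemma labelled_atom_measurable: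
  "is_partition M r \<alpha> \<Longrightarrow> labelled_atom \<alpha> e i \<in> sets M"
  unfolding labelled_atom_def by (intro sets.finite_Union) (auto simp: is_partition_def)

lemma labelled_atom_disjoint:
  assumes "is_partition M r \<alpha>" "x \<in> labelled_atom \<alpha> e i" "x \<in> labelled_atom \<alpha> e j"
  shows "i = j"
  using assms disjointD[OF is_partitionD(4)[OF assms(1)]] unfolding labelled_atom_def by blast

text \<open>A prescribed atom receives label 0 and the others are numbered from 1. This lets the L2
  argument follow a sequence of chosen atoms under one fixed label.\<close>

lemma ex_labelling:
  assumes "is_partition M r \<alpha>" "A \<in> \<alpha>"
  obtains e :: "'a set \<Rightarrow> nat" where "inj_on e \<alpha>" "e ` \<alpha> \<subseteq> {..<r}" "e A = 0"
proof -
  note \<alpha> = is_partitionD[OF assms(1)]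
  obtain h where h: "bij_betw h (\<alpha> - {A}) {0..<card (\<alpha> - {A})}"
    using ex_bij_betw_finite_nat[of "\<alpha> - {A}"] \<alpha>(1) by auto
  define e where "e B = (if B = A then 0 else Suc (h B))" for B
  have "inj_on e \<alpha>"
  proof (rule inj_onI)
    fix B C assume "B \<in> \<alpha>" "C \<in> \<alpha>" "e B = e C"
    then show "B = C"
      using inj_onD[OF bij_betw_imp_inj_on[OF h], of B C] by (simp add: e_def split: if_splits)
  qed
  moreover have "e B < r" if "B \<in> \<alpha>" for B
  proof -
    have "card (\<alpha> - {A}) < r"
      using \<alpha>(1,2) assms(2) by (meson card_Diff1_less order_less_le_trans)
    moreover have "h B < card (\<alpha> - {A})" if "B \<noteq> A"
      using bij_betwE[OF h] that \<open>B \<in> \<alpha>\<close> by auto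
    ultimately show ?thesis by (cases "B = A") (simp_all add: e_def)
  qed
  moreover have "e A = 0" by (simp add: e_def)
  ultimately show ?thesis using that by blast
qed

context prob_space
begin

text \<open>Diagonal extraction makes the labelled approximations along the \<open>k\<close>-th family constant from
  the \<open>k\<close>-th term on, so consecutive labelled partitions differ on a set of measure at most
  \<open>2 / 2 ^ k\<close>; the limit atoms are the sets of points with eventually constant label.\<close>

lemma labelled_partitions_convergent_subsequence:
  fixes a :: "nat \<Rightarrow> 'a set set"
  assumes K: "K \<subseteq> partitions M r" and "uniformly_approximable M K"
    and a: "\<And>n. a n \<in> K" and e: "\<And>n. inj_on (e n) (a n)" "\<And>n. e n ` a n \<subseteq> {..<r}"
  obtains \<sigma> B where "strict_mono \<sigma>" "range B \<subseteq> sets M" "disjoint_family (B :: nat \<Rightarrow> 'a set)"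
    "(\<lambda>n. prob (space M - (\<Union>i<r. B i \<inter> labelled_atom (a (\<sigma> n)) (e (\<sigma> n)) i))) \<longlonglongrightarrow> 0"
proof -
  define L where "L n = labelled_atom (a n) (e n)" for n
  have part: "is_partition M r (a n)" for n using a K by (auto simp: partitions_def)
  have L_sets: "L n i \<in> sets M" for n i
    unfolding L_def using part by (rule labelled_atom_measurable)
  have L_disj: "i = j" if "x \<in> L n i" "x \<in> L n j" for x n i j
    using labelled_atom_disjoint[OF part] that unfolding L_def by blast
  have "\<exists>S. finite S \<and> S \<subseteq> sets M \<and> (\<forall>\<alpha>\<in>K. approximable M \<alpha> S ((1 / 2) ^ k))" for k :: nat
    using assms(2) unfolding uniformly_approximable_def by simp
  then obtain S where S: "\<And>k. finite (S k)" "\<And>k. S k \<subseteq> sets M"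
    "\<And>k \<alpha>. \<alpha> \<in> K \<Longrightarrow> approximable M \<alpha> (S k) ((1 / 2) ^ k)"
    by metis
  have "\<exists>f. range f \<subseteq> a n \<and> prob (error_set M (S k) f) \<le> (1 / 2) ^ k" for n k
    using S(3)[OF a] unfolding approximable_def by blast
  then obtain f where f: "\<And>n k. range (f n k) \<subseteq> a n"
    "\<And>n k. prob (error_set M (S k) (f n k)) \<le> (1 / 2) ^ k"
    by metis
  \<comment> \<open>Restriction to \<open>Pow (S k)\<close> puts all \<open>g n k\<close> of one
    level into a finite set of functions, so that some value recurs infinitely often along any
    sequence.\<close>
  define g where "g n k = restrict (\<lambda>T. e n (f n k T)) (Pow (S k))" for n k
  have g: "g n k \<in> Pow (S k) \<rightarrow>\<^sub>E {..<r}" for n k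
    using e(2) f(1) unfolding g_def by (auto simp: image_subset_iff)
  have err: "x \<in> L n (g n k (pattern (S k) x))" if "x \<in> space M" "x \<notin> error_set M (S k) (f n k)" for x n k
  proof -
    have "x \<in> f n k (pattern (S k) x)" using that by (auto simp: error_set_def)
    moreover have "L n (g n k (pattern (S k) x)) = f n k (pattern (S k) x)"
      using f(1) pattern_in_Pow[of "S k" x] labelled_atom_mem[OF e(1)]
      unfolding g_def L_def by (auto simp: image_subset_iff)
    ultimately show ?thesis by simp
  qed
  \<comment> \<open>Agreement of all label functions of level \<open>k\<close> along
    \<open>s\<close>; this is inherited by subsequences, as diagonal extraction requires.\<close>
  define P where "P k s \<longleftrightarrow> (\<forall>m n. g (s m) k = g (s n) k)" for k and s :: "nat \<Rightarrow> nat"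
  interpret subseqs P
  proof
    fix k and s :: "nat \<Rightarrow> nat" assume "strict_mono s"
    have "finite (range (\<lambda>n. g (s n) k))"
      using g finite_PiE[of "Pow (S k)" "\<lambda>_. {..<r}"] S(1)
      by (intro finite_subset[of "range (\<lambda>n. g (s n) k)" "Pow (S k) \<rightarrow>\<^sub>E {..<r}"]) auto
    then obtain c where "infinite {n. g (s n) k = c}"
      using pigeonhole_infinite[of UNIV "\<lambda>n. g (s n) k"] by auto
    then have "strict_mono (enumerate {n. g (s n) k = c})"
      "\<And>m. g (s (enumerate {n. g (s n) k = c} m)) k = c"
      using strict_mono_enumerate enumerate_in_set by (blast, fastforce)
    then show "\<exists>r'. strict_mono r' \<and> P k (s \<circ> r')"
      unfolding P_def by (intro exI[of _ "enumerate {n. g (s n) k = c}"]) auto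
  qed
  \<comment> \<open>The diagonal sequence is controlled at level \<open>k\<close> only from index
    \<open>Suc k\<close> on; the shift makes \<sigma> stable at level \<open>k\<close> from
    \<open>k\<close> on.\<close>
  define \<sigma> where "\<sigma> n = diagseq (Suc n)" for n
  have \<sigma>: "strict_mono \<sigma>"
    using subseq_diagseq unfolding strict_mono_def \<sigma>_def by simp
  have stable: "g (\<sigma> m) k = g (\<sigma> k) k" if "k \<le> m" for k m
  proof -
    have "P k (diagseq \<circ> (+) (Suc k))"
      by (rule diagseq_holds) (auto simp: P_def)
    then have "g ((diagseq \<circ> (+) (Suc k)) (m - k)) k = g ((diagseq \<circ> (+) (Suc k)) 0) k"
      unfolding P_def by blast
    then show ?thesis using that by (simp add: \<sigma>_def)
  qed
  \<comment> \<open>Off \<open>Z k\<close> the guesses of level \<open>k\<close> are right for both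
    \<sigma> k and \<sigma> (k+1). Since their label functions agree, a point there has the same
    label in both partitions.\<close>
  define Z where "Z k = error_set M (S k) (f (\<sigma> k) k) \<union> error_set M (S k) (f (\<sigma> (Suc k)) k)" for k
  define R where "R n = (\<Union>k. Z (k + n))" for n
  define B where "B i = space M \<inter> (\<Union>n. \<Inter>m\<in>{n..}. L (\<sigma> m) i)" for i
  have err_sets: "error_set M (S k) (f n k) \<in> sets M" for n k
    using S f(1) is_partitionD(3)[OF part] by (intro error_set_measurable) blast+
  have Z_sets: "Z k \<in> sets M" for k unfolding Z_def using err_sets by blast
  have R_sets: "R n \<in> sets M" for n unfolding R_def using Z_sets by blast
  have Z_le: "prob (Z k) \<le> 2 * (1 / 2) ^ k" for k
    using measure_Un_le[OF err_sets err_sets, of k "\<sigma> k" k "\<sigma> (Suc k)"]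
      f(2)[of k "\<sigma> k"] f(2)[of k "\<sigma> (Suc k)"]
    unfolding Z_def by linarith
  have R_le: "prob (R n) \<le> 4 * (1 / 2) ^ n" for n
  proof -
    have sm: "summable (\<lambda>k. 2 * (1 / 2 :: real) ^ (k + n))"
      by (simp add: power_add summable_mult2 summable_geometric)
    have le: "prob (Z (k + n)) \<le> 2 * (1 / 2) ^ (k + n)" for k by (rule Z_le)
    have sZ: "summable (\<lambda>k. prob (Z (k + n)))"
      by (rule summable_comparison_test'[OF sm, of 0]) (use le in auto)
    have "prob (R n) \<le> (\<Sum>k. prob (Z (k + n)))"
      unfolding R_def using Z_sets sZ by (intro finite_measure_subadditive_countably) auto
    also have "\<dots> \<le> (\<Sum>k. 2 * (1 / 2) ^ (k + n))"
      using le sZ sm by (intro suminf_le)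
    also have "\<dots> = (\<Sum>k. (1 / 2) ^ k * (2 * (1 / 2 :: real) ^ n))"
      by (simp add: power_add mult_ac)
    also have "\<dots> = (\<Sum>k. (1 / 2) ^ k) * (2 * (1 / 2 :: real) ^ n)"
      by (intro suminf_mult2[symmetric] summable_geometric) auto
    also have "(\<Sum>k. (1 / 2) ^ k) = (2 :: real)"
      using suminf_geometric[of "1 / 2 :: real"] by simp
    finally show ?thesis by simp
  qed
  have B_sets: "B i \<in> sets M" for i
    unfolding B_def using L_sets by (intro sets.Int sets.countable_UN sets.countable_INT) auto
  have B_disj: "disjoint_family B"
    unfolding disjoint_family_on_def
  proof (intro ballI impI)
    fix i j :: nat assume "i \<noteq> j"
    show "B i \<inter> B j = {}"
    proof (rule ccontr)
      assume "B i \<inter> B j \<noteq> {}"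
      then obtain x where "x \<in> B i" "x \<in> B j" by blast
      then obtain n m where nm: "\<forall>k\<ge>n. x \<in> L (\<sigma> k) i" "\<forall>k\<ge>m. x \<in> L (\<sigma> k) j"
        unfolding B_def by auto
      have "i = j"
        by (rule L_disj[of x "\<sigma> (max m n)"]) (use nm in simp_all)
      then show False using \<open>i \<noteq> j\<close> by contradiction
    qed
  qed
  have sub: "space M - (\<Union>i<r. B i \<inter> L (\<sigma> n) i) \<subseteq> R n" for n
  proof
    fix x assume x: "x \<in> space M - (\<Union>i<r. B i \<inter> L (\<sigma> n) i)"
    show "x \<in> R n"
    proof (rule ccontr)
      assume nR: "x \<notin> R n"
      then have nZ: "x \<notin> Z m" if "m \<ge> n" for m
        using that unfolding R_def by (metis UNIV_I UN_I le_add_diff_inverse2)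
      \<comment> \<open>The label of \<open>x\<close> at stage \<open>n\<close>. It persists at all
        later stages, because \<open>x\<close> avoids every later \<open>Z m\<close> and has only
        one label in each partition.\<close>
      define i where "i = g (\<sigma> n) n (pattern (S n) x)"
      have "x \<in> L (\<sigma> m) i" if "m \<ge> n" for m
        using that
      proof (induction m rule: dec_induct)
        case base
        then show ?case unfolding i_def using nZ[of n] x by (intro err) (auto simp: Z_def)
      next
        case (step m)
        let ?j = "g (\<sigma> m) m (pattern (S m) x)"
        have "x \<in> L (\<sigma> m) ?j" using nZ[of m] x step by (intro err) (auto simp: Z_def)
        moreover have "x \<in> L (\<sigma> (Suc m)) (g (\<sigma> (Suc m)) m (pattern (S m) x))"
          using nZ[of m] x step by (intro err) (auto simp: Z_def)
        ultimately show ?case using step.IH L_disj stable[of m "Suc m"] by auto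
      qed
      then have "x \<in> B i" "x \<in> L (\<sigma> n) i" using x by (auto simp: B_def)
      moreover have "i < r" using g[of "\<sigma> n" n] pattern_in_Pow[of "S n" x] unfolding i_def by blast
      ultimately show False using x by auto
    qed
  qed
  have "(\<lambda>n. prob (space M - (\<Union>i<r. B i \<inter> L (\<sigma> n) i))) \<longlonglongrightarrow> 0"
  proof (rule Lim_null_comparison[OF always_eventually])
    show "\<forall>n. norm (prob (space M - (\<Union>i<r. B i \<inter> L (\<sigma> n) i))) \<le> 4 * (1 / 2) ^ n"
      using finite_measure_mono[OF sub R_sets] R_le by (auto intro: order_trans)
    show "(\<lambda>n. 4 * (1 / 2 :: real) ^ n) \<longlonglongrightarrow> 0"
      by (intro tendsto_mult_right_zero LIMSEQ_power_zero) auto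
  qed
  moreover have "range B \<subseteq> sets M" using B_sets by blast
  ultimately show ?thesis using that[OF \<sigma> _ B_disj] unfolding L_def by simp
qed

text \<open>Outside \<open>G n\<close> the point carries the same label in the n-th partition and in
  the limit, so each of the two is approximable from the other with error at most the measure of
  \<open>G n\<close>; \<open>fano\<close> turns this into convergence in the Rokhlin metric.\<close>

lemma uniformly_approximable_imp_rho_precompact:
  assumes K: "K \<subseteq> partitions M r" and "uniformly_approximable M K"
  shows "rho_precompact M r K"
  unfolding rho_precompact_def
proof (intro allI impI)
  fix a :: "nat \<Rightarrow> 'a set set" assume "\<forall>n. a n \<in> K"
  then have a: "\<And>n. a n \<in> K" and part: "\<And>n. is_partition M r (a n)"
    using K by (auto simp: partitions_def)
  have "\<exists>e::'a set \<Rightarrow> nat. inj_on e (a n) \<and> e ` a n \<subseteq> {..<r}" for n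
    using ex_labelling[OF part] is_partition_nonempty[OF part] by (metis equals0I)
  then obtain e :: "nat \<Rightarrow> 'a set \<Rightarrow> nat" where
    e: "\<And>n. inj_on (e n) (a n)" "\<And>n. e n ` a n \<subseteq> {..<r}" by metis
  obtain \<sigma> B where \<sigma>: "strict_mono \<sigma>" and B': "range B \<subseteq> sets M" "disjoint_family (B :: nat \<Rightarrow> 'a set)"
    and lim: "(\<lambda>n. prob (space M - (\<Union>i<r. B i \<inter> labelled_atom (a (\<sigma> n)) (e (\<sigma> n)) i))) \<longlonglongrightarrow> 0"
    by (rule labelled_partitions_convergent_subsequence[where a=a and e=e, OF assms a e])
  then have B: "\<And>i. B i \<in> sets M" "disjoint_family B" by auto
  define \<beta> where "\<beta> = B ` {..<r}"
  define L where "L n = labelled_atom (a (\<sigma> n)) (e (\<sigma> n))" for n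
  define G where "G n = space M - (\<Union>i<r. B i \<inter> L n i)" for n
  have lim: "(\<lambda>n. prob (G n)) \<longlonglongrightarrow> 0" using lim by (simp add: G_def L_def)
  have L_sets: "L n i \<in> sets M" for n i unfolding L_def using part by (rule labelled_atom_measurable)
  have G_sets: "G n \<in> sets M" for n unfolding G_def using B(1) L_sets by blast
  have \<beta>: "is_partition M r \<beta>"
  proof -
    have "card \<beta> \<le> r" unfolding \<beta>_def using card_image_le[of "{..<r}" B] by simp
    moreover have "disjoint \<beta>"
      unfolding \<beta>_def using B(2) disjoint_family_on_disjoint_image disjoint_family_on_mono
      by (metis subset_UNIV)
    \<comment> \<open>The limit sets cover the space mod 0 because their complement lies in every
      \<open>G n\<close>.\<close>
    moreover have "prob (space M - \<Union>\<beta>) \<le> prob (G n)" for n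
      using G_sets by (intro finite_measure_mono) (auto simp: G_def \<beta>_def)
    then have "prob (space M - \<Union>\<beta>) \<le> 0" using LIMSEQ_le_const[OF lim] by blast
    then have "prob (space M - \<Union>\<beta>) = 0" by (simp add: measure_le_0_iff)
    ultimately show ?thesis using B(1) by (auto simp: is_partition_def \<beta>_def)
  qed
  have r: "r > 0" using is_partition_nonempty[OF \<beta>] by (auto simp: \<beta>_def)
  have ab: "approximable M (a (\<sigma> n)) \<beta> (prob (G n))" for n
  proof -
    let ?\<alpha> = "a (\<sigma> n)" and ?e = "e (\<sigma> n)"
    obtain A0 where A0: "A0 \<in> ?\<alpha>" using is_partition_nonempty[OF part] by blast
    define f where "f T = (if \<exists>A\<in>?\<alpha>. T = {B (?e A)} then
      (SOME A. A \<in> ?\<alpha> \<and> T = {B (?e A)}) else A0)" for T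
    have f1: "f T \<in> ?\<alpha> \<and> T = {B (?e (f T))}" if "\<exists>A\<in>?\<alpha>. T = {B (?e A)}" for T
    proof -
      have "\<exists>A. A \<in> ?\<alpha> \<and> T = {B (?e A)}" using that by blast
      from someI_ex[OF this] that show ?thesis by (simp add: f_def)
    qed
    have f: "range f \<subseteq> ?\<alpha>"
    proof
      fix A assume "A \<in> range f"
      then obtain T where "A = f T" by auto
      then show "A \<in> ?\<alpha>" using f1[of T] A0 by (cases "\<exists>A\<in>?\<alpha>. T = {B (?e A)}") (auto simp: f_def)
    qed
    have "error_set M \<beta> f \<subseteq> G n"
    proof
      fix x assume x: "x \<in> error_set M \<beta> f"
      show "x \<in> G n"
      proof (rule ccontr)
        assume "x \<notin> G n"
        then obtain i where i: "i < r" "x \<in> B i" "x \<in> L n i"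
          using x by (auto simp: G_def error_set_def)
        then obtain A where A: "A \<in> ?\<alpha>" "?e A = i" "x \<in> A"
          by (auto simp: L_def labelled_atom_def)
        have p: "pattern \<beta> x = {B i}"
          using i is_partitionD(4)[OF \<beta>] by (intro pattern_partition) (auto simp: \<beta>_def)
        have "f {B i} \<in> ?\<alpha> \<and> {B i} = {B (?e (f {B i}))}" using A by (intro f1) auto
        then have *: "f {B i} \<in> ?\<alpha>" "B i = B (?e (f {B i}))" by auto
        \<comment> \<open>Equal limit sets may carry different indices only when they are empty;
          \<open>x\<close> lies in \<open>B i\<close>, so its index is recovered.\<close>
        have "?e (f {B i}) = i"
          using B(2) i(2) *(2) unfolding disjoint_family_on_def by (metis IntI UNIV_I empty_iff)
        then have "f {B i} = A" using * A inj_onD[OF e(1)] by metis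
        then show False using x A p by (auto simp: error_set_def)
      qed
    qed
    then show ?thesis
      unfolding approximable_def using f G_sets by (intro exI[of _ f]) (auto intro: finite_measure_mono)
  qed
  have ba: "approximable M \<beta> (a (\<sigma> n)) (prob (G n))" for n
  proof -
    let ?\<alpha> = "a (\<sigma> n)" and ?e = "e (\<sigma> n)"
    \<comment> \<open>On the union of the partition the pattern is a singleton and
      \<open>the_elem\<close> names the atom; the default \<open>B 0\<close> belongs to \<beta>
      since \<open>r\<close> is positive.\<close>
    define f where "f T = (if the_elem T \<in> ?\<alpha> then B (?e (the_elem T)) else B 0)" for T
    have f: "range f \<subseteq> \<beta>" using e(2)[of "\<sigma> n"] r by (auto simp: f_def \<beta>_def image_subset_iff)
    have "error_set M ?\<alpha> f \<subseteq> G n"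
    proof
      fix x assume x: "x \<in> error_set M ?\<alpha> f"
      show "x \<in> G n"
      proof (rule ccontr)
        assume "x \<notin> G n"
        then obtain i where i: "i < r" "x \<in> B i" "x \<in> L n i"
          using x by (auto simp: G_def error_set_def)
        then obtain A where A: "A \<in> ?\<alpha>" "?e A = i" "x \<in> A"
          by (auto simp: L_def labelled_atom_def)
        have "pattern ?\<alpha> x = {A}"
          using A is_partitionD(4)[OF part] by (intro pattern_partition)
        then show False using x i A by (auto simp: error_set_def f_def)
      qed
    qed
    then show ?thesis
      unfolding approximable_def using f G_sets by (intro exI[of _ f]) (auto intro: finite_measure_mono)
  qed
  have "(\<lambda>n. rokhlin M (a (\<sigma> n)) \<beta>) \<longlonglongrightarrow> 0"
  proof (rule LIMSEQ_I)
    fix \<epsilon> :: real assume "0 < \<epsilon>"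
    then obtain \<eta> where "0 < \<eta>" and \<eta>: "\<And>\<alpha> \<beta> q. is_partition M r \<alpha> \<Longrightarrow> is_partition M q \<beta>
      \<Longrightarrow> approximable M \<alpha> \<beta> \<eta> \<Longrightarrow> cond_entropy_part M \<alpha> \<beta> \<le> \<epsilon> / 3"
      using fano[of "\<epsilon> / 3" r] by (metis zero_less_divide_iff zero_less_numeral)
    from order_tendstoD(2)[OF lim \<open>0 < \<eta>\<close>] obtain N where N: "\<And>n. n \<ge> N \<Longrightarrow> prob (G n) < \<eta>"
      by (auto simp: eventually_sequentially)
    show "\<exists>N. \<forall>n\<ge>N. norm (rokhlin M (a (\<sigma> n)) \<beta> - 0) < \<epsilon>"
    proof (intro exI allI impI)
      fix n assume "N \<le> n"
      then have "prob (G n) \<le> \<eta>" using N by (simp add: less_imp_le)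
      then have "cond_entropy_part M (a (\<sigma> n)) \<beta> \<le> \<epsilon> / 3" "cond_entropy_part M \<beta> (a (\<sigma> n)) \<le> \<epsilon> / 3"
        using \<eta> part \<beta> ab ba approximable_mono by blast+
      moreover have "0 \<le> cond_entropy_part M (a (\<sigma> n)) \<beta>" "0 \<le> cond_entropy_part M \<beta> (a (\<sigma> n))"
        using is_partitionD(3)[OF part] is_partitionD(3)[OF \<beta>]
        by (auto intro!: cond_entropy_part_nonneg)
      ultimately show "norm (rokhlin M (a (\<sigma> n)) \<beta> - 0) < \<epsilon>"
        using \<open>0 < \<epsilon>\<close> by (simp add: rokhlin_def)
    qed
  qed
  then show "\<exists>\<sigma> \<beta>. strict_mono \<sigma> \<and> \<beta> \<in> partitions M r \<and> (\<lambda>n. rokhlin M (a (\<sigma> n)) \<beta>) \<longlonglongrightarrow> 0"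
    using \<sigma> \<beta> by (auto simp: partitions_def)
qed

section \<open>Precompactness of the atoms in \<open>L\<^sup>2\<close>\<close>

lemma integral_indicator_diff_square:
  fixes A B :: "'a set"
  assumes "A \<in> sets M" "B \<in> sets M"
  shows "(LINT x|M. (indicator A x - indicator B x :: real)\<^sup>2) = prob ((A - B) \<union> (B - A))"
proof -
  have "(LINT x|M. (indicator A x - indicator B x :: real)\<^sup>2)
      = (LINT x|M. indicator ((A - B) \<union> (B - A)) x)"
    by (intro Bochner_Integration.integral_cong) (auto simp: indicator_def)
  also have "\<dots> = prob ((A - B) \<union> (B - A))" using assms by simp
  finally show ?thesis .
qed

text \<open>The chosen atoms all have label 0, so they converge to \<open>B 0\<close>: a point in
  their symmetric difference can have no label common to the partition and the limit.\<close>

lemma uniformly_approximable_imp_L2_precompact: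
  assumes K: "K \<subseteq> partitions M r" and "uniformly_approximable M K"
  shows "L2_precompact M (atom_indicators K)"
  unfolding L2_precompact_def
proof (intro allI impI)
  fix f :: "nat \<Rightarrow> 'a \<Rightarrow> real" assume "\<forall>n. f n \<in> atom_indicators K"
  then have "\<forall>n. \<exists>A \<alpha>. f n = indicator A \<and> \<alpha> \<in> K \<and> A \<in> \<alpha>" by (auto simp: atom_indicators_def)
  then obtain A a where fA: "\<And>n. f n = indicator (A n)" and a: "\<And>n. a n \<in> K" and A: "\<And>n. A n \<in> a n"
    by metis
  have part: "is_partition M r (a n)" for n using a K by (auto simp: partitions_def)
  have "\<exists>e::'a set \<Rightarrow> nat. inj_on e (a n) \<and> e ` a n \<subseteq> {..<r} \<and> e (A n) = 0" for n
    using ex_labelling[OF part A] by metis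
  then obtain e :: "nat \<Rightarrow> 'a set \<Rightarrow> nat" where
    e: "\<And>n. inj_on (e n) (a n)" "\<And>n. e n ` a n \<subseteq> {..<r}" and e0: "\<And>n. e n (A n) = 0" by metis
  obtain \<sigma> B where \<sigma>: "strict_mono \<sigma>" and B': "range B \<subseteq> sets M" "disjoint_family (B :: nat \<Rightarrow> 'a set)"
    and lim: "(\<lambda>n. prob (space M - (\<Union>i<r. B i \<inter> labelled_atom (a (\<sigma> n)) (e (\<sigma> n)) i))) \<longlonglongrightarrow> 0"
    by (rule labelled_partitions_convergent_subsequence[where a=a and e=e, OF assms a e])
  then have B: "\<And>i. B i \<in> sets M" "disjoint_family B" by auto
  have A_sets: "A n \<in> sets M" for n using A is_partitionD(3)[OF part] by blast
  have le: "(LINT x|M. (f (\<sigma> n) x - indicator (B 0) x)\<^sup>2)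
      \<le> prob (space M - (\<Union>i<r. B i \<inter> labelled_atom (a (\<sigma> n)) (e (\<sigma> n)) i))" for n
  proof -
    let ?L = "labelled_atom (a (\<sigma> n)) (e (\<sigma> n))"
    have L0: "?L 0 = A (\<sigma> n)" using labelled_atom_mem[OF e(1) A, of "\<sigma> n"] e0 by simp
    have "(A (\<sigma> n) - B 0) \<union> (B 0 - A (\<sigma> n)) \<subseteq> space M - (\<Union>i<r. B i \<inter> ?L i)"
    proof
      fix x assume x: "x \<in> (A (\<sigma> n) - B 0) \<union> (B 0 - A (\<sigma> n))"
      have "x \<notin> B i \<inter> ?L i" for i
      proof
        assume i: "x \<in> B i \<inter> ?L i"
        then have "x \<in> A (\<sigma> n) \<Longrightarrow> i = 0"
          using labelled_atom_disjoint[OF part, of x] L0 by blast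
        moreover have "x \<in> B 0 \<Longrightarrow> i = 0"
          using i B(2) unfolding disjoint_family_on_def by blast
        ultimately show False using x i L0 by auto
      qed
      moreover have "x \<in> space M" using x A_sets B(1) sets.sets_into_space by blast
      ultimately show "x \<in> space M - (\<Union>i<r. B i \<inter> ?L i)" by blast
    qed
    moreover have "space M - (\<Union>i<r. B i \<inter> ?L i) \<in> sets M"
      using B(1) labelled_atom_measurable[OF part] by blast
    ultimately show ?thesis
      unfolding fA integral_indicator_diff_square[OF A_sets B(1)] by (rule finite_measure_mono)
  qed
  have "(\<lambda>n. LINT x|M. (f (\<sigma> n) x - indicator (B 0) x)\<^sup>2) \<longlonglongrightarrow> 0"
    by (rule tendsto_sandwich[OF _ _ tendsto_const lim]) (use le in auto)
  then have "(\<lambda>n. sqrt (LINT x|M. (f (\<sigma> n) x - indicator (B 0) x)\<^sup>2)) \<longlonglongrightarrow> 0"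
    using tendsto_real_sqrt by fastforce
  moreover have "integrable M (\<lambda>x. (indicator (B 0) x :: real)\<^sup>2)"
    using B(1)[of 0] by (intro integrable_const_bound[where B=1]) (auto simp: indicator_def)
  ultimately show "\<exists>\<sigma> g. strict_mono \<sigma> \<and> g \<in> borel_measurable M \<and> integrable M (\<lambda>x. (g x)\<^sup>2) \<and>
      (\<lambda>n. sqrt (LINT x|M. (f (\<sigma> n) x - g x)\<^sup>2)) \<longlonglongrightarrow> 0"
    using \<sigma> B(1)[of 0] by (intro exI[of _ \<sigma>] exI[of _ "indicator (B 0)"]) auto
qed

text \<open>Sequential precompactness gives total boundedness: without a finite net, greedy choice
  yields atoms pairwise at least \<eta> apart, yet two late terms of a convergent subsequence are
  closer.\<close>

lemma L2_precompact_imp_finite_net: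
  assumes K: "K \<subseteq> partitions M r" and "L2_precompact M (atom_indicators K)" and "0 < \<eta>"
  shows "\<exists>S. finite S \<and> S \<subseteq> \<Union>K \<and> (\<forall>A\<in>\<Union>K. \<exists>B\<in>S. prob ((A - B) \<union> (B - A)) < \<eta>)"
    (is "\<exists>S. ?net S")
proof (rule ccontr)
  assume neg: "\<nexists>S. ?net S"
  have "\<exists>A\<in>\<Union>K. \<forall>B\<in>F. \<eta> \<le> prob ((A - B) \<union> (B - A))" if "finite F" "F \<subseteq> \<Union>K" for F
  proof (rule ccontr)
    assume "\<not> (\<exists>A\<in>\<Union>K. \<forall>B\<in>F. \<eta> \<le> prob ((A - B) \<union> (B - A)))"
    then have "\<forall>A\<in>\<Union>K. \<exists>B\<in>F. prob ((A - B) \<union> (B - A)) < \<eta>"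
      by (simp add: not_le)
    with that have "?net F" by (intro conjI)
    with neg show False by (simp only: not_ex)
  qed
  then obtain A where A: "\<And>n::nat. A n \<in> \<Union>K"
    "\<And>n. \<forall>B\<in>A ` {..<n}. \<eta> \<le> prob ((A n - B) \<union> (B - A n))"
    using dependent_sequence[of "\<Union>K" "\<lambda>F A. \<forall>B\<in>F. \<eta> \<le> prob ((A - B) \<union> (B - A))"] by metis
  define f where "f n = (indicator (A n) :: 'a \<Rightarrow> real)" for n
  have "\<forall>n. f n \<in> atom_indicators K" using A(1) unfolding f_def atom_indicators_def by blast
  with assms(2) obtain \<sigma> g where \<sigma>: "strict_mono \<sigma>" and g: "g \<in> borel_measurable M"
    "integrable M (\<lambda>x. (g x)\<^sup>2)" and lim: "(\<lambda>n. sqrt (LINT x|M. (f (\<sigma> n) x - g x)\<^sup>2)) \<longlonglongrightarrow> 0"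
    unfolding L2_precompact_def by meson
  have A_sets: "A n \<in> sets M" for n
    using A(1)[of n] K is_partitionD(3) by (fastforce simp: partitions_def)
  \<comment> \<open>Integrability comes first, since the Bochner integral of a non-integrable
    function is 0 and would not allow the comparison below.\<close>
  have int: "integrable M (\<lambda>x. (f n x - g x)\<^sup>2)" for n
  proof (rule Bochner_Integration.integrable_bound)
    show "integrable M (\<lambda>x. 2 + 2 * (g x)\<^sup>2)" using g by simp
    show "(\<lambda>x. (f n x - g x)\<^sup>2) \<in> borel_measurable M"
      unfolding f_def using A_sets g(1) by measurable
    have "(f n x - g x)\<^sup>2 \<le> 2 + 2 * (g x)\<^sup>2" for x
    proof -
      have "(f n x - g x)\<^sup>2 \<le> 2 * (f n x)\<^sup>2 + 2 * (g x)\<^sup>2"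
        using sum_squares_bound[of "f n x" "- g x"] by (simp add: power2_diff)
      also have "(f n x)\<^sup>2 \<le> 1" by (simp add: f_def indicator_def)
      finally show ?thesis by simp
    qed
    then show "AE x in M. norm ((f n x - g x)\<^sup>2) \<le> norm (2 + 2 * (g x)\<^sup>2)" by simp
  qed
  have nonneg: "0 \<le> (LINT x|M. (f n x - g x)\<^sup>2)" for n by simp
  have "(\<lambda>n. (sqrt (LINT x|M. (f (\<sigma> n) x - g x)\<^sup>2))\<^sup>2) \<longlonglongrightarrow> 0"
    using tendsto_power[OF lim, of 2] by simp
  then have "(\<lambda>n. LINT x|M. (f (\<sigma> n) x - g x)\<^sup>2) \<longlonglongrightarrow> 0" using nonneg by simp
  \<comment> \<open>A quarter, because each of the two squared distances to \<open>g\<close> enters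
    the final estimate with factor 2.\<close>
  from order_tendstoD(2)[OF this, of "\<eta> / 4"] \<open>0 < \<eta>\<close> obtain N where
    N: "\<And>n. n \<ge> N \<Longrightarrow> (LINT x|M. (f (\<sigma> n) x - g x)\<^sup>2) < \<eta> / 4"
    by (auto simp: eventually_sequentially)
  let ?m = "\<sigma> N" and ?n = "\<sigma> (Suc N)"
  have "prob ((A ?n - A ?m) \<union> (A ?m - A ?n)) = (LINT x|M. (f ?n x - f ?m x)\<^sup>2)"
    unfolding f_def by (rule integral_indicator_diff_square[OF A_sets A_sets, symmetric])
  also have "\<dots> \<le> (LINT x|M. 2 * (f ?n x - g x)\<^sup>2 + 2 * (f ?m x - g x)\<^sup>2)"
  proof (rule integral_mono_AE')
    show "AE x in M. (f ?n x - f ?m x)\<^sup>2 \<le> 2 * (f ?n x - g x)\<^sup>2 + 2 * (f ?m x - g x)\<^sup>2"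
    proof (rule AE_I2)
      fix x
      have "0 \<le> (f ?n x + f ?m x - 2 * g x)\<^sup>2" by simp
      then show "(f ?n x - f ?m x)\<^sup>2 \<le> 2 * (f ?n x - g x)\<^sup>2 + 2 * (f ?m x - g x)\<^sup>2"
        by (simp add: power2_eq_square algebra_simps)
    qed
  qed (use int in auto)
  also have "\<dots> = 2 * (LINT x|M. (f ?n x - g x)\<^sup>2) + 2 * (LINT x|M. (f ?m x - g x)\<^sup>2)"
    using int by simp
  also have "\<dots> < \<eta>" using N[of N] N[of "Suc N"] by simp
  finally have "prob ((A ?n - A ?m) \<union> (A ?m - A ?n)) < \<eta>" .
  moreover have "?m < ?n" using \<sigma> by (simp add: strict_mono_def)
  ultimately show False using A(2)[of ?n] by (simp add: not_le[symmetric])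
qed

text \<open>The net serves as the family. Off the small symmetric differences, a point lies in
  \<open>A\<close> exactly when it lies in the net member \<open>F A\<close>, which its pattern
  shows.\<close>

lemma L2_precompact_imp_uniformly_approximable:
  assumes K: "K \<subseteq> partitions M r" and "L2_precompact M (atom_indicators K)"
  shows "uniformly_approximable M K"
  unfolding uniformly_approximable_def
proof (intro allI impI)
  fix \<eta> :: real assume "0 < \<eta>"
  \<comment> \<open>The errors of at most \<open>r\<close> atoms are added; the extra 1 keeps the
    denominator positive.\<close>
  define \<theta> where "\<theta> = \<eta> / (real r + 1)"
  have "0 < \<theta>" using \<open>0 < \<eta>\<close> by (simp add: \<theta>_def)
  from L2_precompact_imp_finite_net[OF assms this] obtain S where S: "finite S" "S \<subseteq> \<Union>K"
    "\<forall>A\<in>\<Union>K. \<exists>B\<in>S. prob ((A - B) \<union> (B - A)) < \<theta>" by blast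
  have part: "is_partition M r \<alpha>" if "\<alpha> \<in> K" for \<alpha> using that K by (auto simp: partitions_def)
  have S_sets: "S \<subseteq> sets M" using S(2) is_partitionD(3)[OF part] by blast
  obtain F where F: "\<And>A. A \<in> \<Union>K \<Longrightarrow> F A \<in> S"
    "\<And>A. A \<in> \<Union>K \<Longrightarrow> prob ((A - F A) \<union> (F A - A)) < \<theta>"
    using S(3) by metis
  have "approximable M \<alpha> S \<eta>" if "\<alpha> \<in> K" for \<alpha>
  proof -
    note \<alpha> = is_partitionD[OF part[OF that]] and null = is_partition_null[OF part[OF that]]
      and nonempty = is_partition_nonempty[OF part[OF that]]
    obtain A0 where A0: "A0 \<in> \<alpha>" using nonempty by blast
    \<comment> \<open>The choice need not be unique: off the sets \<open>D A\<close>, every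
      \<open>A\<close> with \<open>F A\<close> in the pattern contains the point.\<close>
    define f where "f T = (if \<exists>A\<in>\<alpha>. F A \<in> T then SOME A. A \<in> \<alpha> \<and> F A \<in> T else A0)" for T
    have f1: "f T \<in> \<alpha> \<and> F (f T) \<in> T" if "\<exists>A\<in>\<alpha>. F A \<in> T" for T
    proof -
      have "\<exists>A. A \<in> \<alpha> \<and> F A \<in> T" using that by blast
      from someI_ex[OF this] that show ?thesis by (simp add: f_def)
    qed
    have f: "range f \<subseteq> \<alpha>"
    proof
      fix A assume "A \<in> range f"
      then obtain T where "A = f T" by auto
      then show "A \<in> \<alpha>" using f1[of T] A0 by (cases "\<exists>A\<in>\<alpha>. F A \<in> T") (auto simp: f_def)
    qed
    define D where "D A = (A - F A) \<union> (F A - A)" for A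
    have D_sets: "D A \<in> sets M" if "A \<in> \<alpha>" for A
    proof -
      have "A \<in> sets M" "F A \<in> sets M" using that \<open>\<alpha> \<in> K\<close> \<alpha>(3) F(1) S_sets by blast+
      then show ?thesis unfolding D_def by blast
    qed
    have UD: "(\<Union>A\<in>\<alpha>. D A) \<in> sets M" using D_sets \<alpha>(1) by blast
    have "error_set M S f \<subseteq> (\<Union>A\<in>\<alpha>. D A) \<union> (space M - \<Union>\<alpha>)"
    proof
      fix x assume x: "x \<in> error_set M S f"
      show "x \<in> (\<Union>A\<in>\<alpha>. D A) \<union> (space M - \<Union>\<alpha>)"
      proof (rule ccontr)
        assume nx: "x \<notin> (\<Union>A\<in>\<alpha>. D A) \<union> (space M - \<Union>\<alpha>)"
        then obtain A where A: "A \<in> \<alpha>" "x \<in> A" using x by (auto simp: error_set_def)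
        then have "F A \<in> pattern S x" using nx F(1) that by (auto simp: pattern_def D_def)
        then have "f (pattern S x) \<in> \<alpha>" "F (f (pattern S x)) \<in> pattern S x"
          using f1 A by blast+
        then have "x \<in> f (pattern S x)" using nx by (auto simp: pattern_def D_def)
        then show False using x by (auto simp: error_set_def)
      qed
    qed
    then have "prob (error_set M S f) \<le> prob ((\<Union>A\<in>\<alpha>. D A) \<union> (space M - \<Union>\<alpha>))"
      using UD null by (intro finite_measure_mono) auto
    also have "\<dots> = prob (\<Union>A\<in>\<alpha>. D A)" using UD null by (rule measure_Un_null_set)
    also have "\<dots> \<le> (\<Sum>A\<in>\<alpha>. prob (D A))"
      using \<alpha>(1) D_sets by (intro finite_measure_subadditive_finite) auto
    also have "\<dots> \<le> (\<Sum>A\<in>\<alpha>. \<theta>)"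
      using F(2) that unfolding D_def by (intro sum_mono less_imp_le) blast
    also have "\<dots> \<le> (real r + 1) * \<theta>"
      using \<alpha>(2) \<open>0 < \<theta>\<close> by (simp add: mult_right_mono)
    also have "\<dots> = \<eta>" by (simp add: \<theta>_def)
    finally show ?thesis using f by (auto simp: approximable_def)
  qed
  then show "\<exists>S. finite S \<and> S \<subseteq> sets M \<and> (\<forall>\<alpha>\<in>K. approximable M \<alpha> S \<eta>)"
    using S(1) S_sets by blast
qed

section \<open>Mean complexity\<close>

lemma pattern_Collect_measurable:
  assumes "finite S" "S \<subseteq> sets M"
  shows "{x \<in> space M. P (pattern S x)} \<in> sets M"
proof -
  have "{x \<in> space M. P (pattern S x)} = (\<Union>T\<in>{T \<in> Pow S. P T}. {x \<in> space M. pattern S x = T})"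
    using pattern_in_Pow[of S] by blast
  also have "\<dots> \<in> sets M"
    by (intro sets.finite_UN pattern_measurable assms) (use assms in auto)
  finally show ?thesis .
qed

text \<open>The Hamming distance from a fixed centre depends on \<open>y\<close> only through its
  pattern in the finite family of all atoms.\<close>

lemma hball_measurable:
  assumes "finite E" "\<And>\<alpha>. \<alpha> \<in> E \<Longrightarrow> is_partition M r \<alpha>"
  shows "hball M E x \<epsilon> \<in> sets M"
proof -
  let ?P = "\<lambda>T. real (card {\<alpha>\<in>E. \<not> (\<exists>A\<in>\<alpha>. x \<in> A \<and> A \<in> T)}) / real (card E) < \<epsilon>"
  have "{\<alpha>\<in>E. \<not> (\<exists>A\<in>\<alpha>. x \<in> A \<and> A \<in> pattern (\<Union>E) y)} = {\<alpha>\<in>E. \<not> (\<exists>A\<in>\<alpha>. x \<in> A \<and> y \<in> A)}" for y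
    by (auto simp: pattern_def)
  then have "hball M E x \<epsilon> = {y \<in> space M. ?P (pattern (\<Union>E) y)}"
    by (simp add: hball_def hamming_def)
  also have "\<dots> \<in> sets M"
  proof (rule pattern_Collect_measurable)
    have "finite \<alpha>" "\<alpha> \<subseteq> sets M" if "\<alpha> \<in> E" for \<alpha>
      using is_partitionD(1,3)[OF assms(2)[OF that]] .
    then show "finite (\<Union>E)" "\<Union>E \<subseteq> sets M"
      using finite_Union[OF assms(1)] by blast+
  qed
  finally show ?thesis .
qed

text \<open>Double counting: the count is a finite sum of indicators. Both directions use it to pass
  between errors per partition and errors per point.\<close>

lemma integral_card_sets:
  assumes "finite E" "\<And>\<alpha>. \<alpha> \<in> E \<Longrightarrow> N \<alpha> \<in> sets M"
  shows "integrable M (\<lambda>x. real (card {\<alpha>\<in>E. x \<in> N \<alpha>}))"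
    and "(LINT x|M. real (card {\<alpha>\<in>E. x \<in> N \<alpha>})) = (\<Sum>\<alpha>\<in>E. prob (N \<alpha>))"
proof -
  have eq: "real (card {\<alpha>\<in>E. x \<in> N \<alpha>}) = (\<Sum>\<alpha>\<in>E. indicator (N \<alpha>) x)" for x
  proof -
    have "{\<alpha>\<in>E. x \<in> N \<alpha>} = E \<inter> {\<alpha>. x \<in> N \<alpha>}" by blast
    then show ?thesis using assms(1) by (simp add: indicator_def)
  qed
  have int: "integrable M (indicator (N \<alpha>) :: _ \<Rightarrow> real)" if "\<alpha> \<in> E" for \<alpha>
    using assms(2)[OF that] by (simp add: emeasure_eq_measure)
  show "integrable M (\<lambda>x. real (card {\<alpha>\<in>E. x \<in> N \<alpha>}))"
    unfolding eq using int by (intro Bochner_Integration.integrable_sum)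
  show "(LINT x|M. real (card {\<alpha>\<in>E. x \<in> N \<alpha>})) = (\<Sum>\<alpha>\<in>E. prob (N \<alpha>))"
    unfolding eq using int assms(2) by (subst Bochner_Integration.integral_sum) auto
qed

text \<open>The centres are one point for each pattern met by the set of points that are badly
  approximated for fewer than half of the allowed proportion of partitions.\<close>

lemma approximable_imp_hball_cover:
  assumes E: "finite E" "E \<noteq> {}" "\<And>\<alpha>. \<alpha> \<in> E \<Longrightarrow> is_partition M r \<alpha>"
    and S: "finite S" "S \<subseteq> sets M" and \<epsilon>: "0 < \<epsilon>"
    and approx: "\<And>\<alpha>. \<alpha> \<in> E \<Longrightarrow> approximable M \<alpha> S (\<epsilon>\<^sup>2 / 3)"
  shows "\<exists>D. finite D \<and> D \<subseteq> space M \<and> card D \<le> 2 ^ card S \<and>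
    prob (\<Union>x\<in>D. hball M E x \<epsilon>) > 1 - \<epsilon>"
proof -
  have "\<exists>f. range f \<subseteq> \<alpha> \<and> prob (error_set M S f) \<le> \<epsilon>\<^sup>2 / 3" if "\<alpha> \<in> E" for \<alpha>
    using approx[OF that] by (simp add: approximable_def)
  then obtain f where f: "\<And>\<alpha>. \<alpha> \<in> E \<Longrightarrow> range (f \<alpha>) \<subseteq> \<alpha>"
    "\<And>\<alpha>. \<alpha> \<in> E \<Longrightarrow> prob (error_set M S (f \<alpha>)) \<le> \<epsilon>\<^sup>2 / 3"
    by metis
  define N where "N \<alpha> = error_set M S (f \<alpha>)" for \<alpha>
  define g where "g y = real (card {\<alpha>\<in>E. y \<in> N \<alpha>})" for y
  \<comment> \<open>Two points with fewer than \<open>c\<close> errors each can be separated by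
    fewer than \<epsilon> \<open>card E\<close> partitions. With mean error \<epsilon>^2/3, Markov's
    inequality bounds the set of worse points by 2\<epsilon>/3.\<close>
  define c where "c = real (card E) * \<epsilon> / 2"
  have cE: "real (card E) > 0" using E(1,2) by (simp add: card_gt_0_iff)
  have c: "c > 0" using cE \<epsilon> by (simp add: c_def)
  have N_sets: "N \<alpha> \<in> sets M" if "\<alpha> \<in> E" for \<alpha>
    unfolding N_def using S f(1)[OF that] is_partitionD(3)[OF E(3)[OF that]]
    by (intro error_set_measurable) auto
  have int: "integrable M g" "(LINT x|M. g x) = (\<Sum>\<alpha>\<in>E. prob (N \<alpha>))"
    unfolding g_def using integral_card_sets[OF E(1) N_sets] by auto
  have "(LINT x|M. g x) \<le> (\<Sum>\<alpha>\<in>E. \<epsilon>\<^sup>2 / 3)"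
    unfolding int N_def using f(2) by (rule sum_mono)
  then have "(LINT x|M. g x) \<le> real (card E) * (\<epsilon>\<^sup>2 / 3)" by simp
  moreover have "prob {x \<in> space M. g x \<ge> c} \<le> (LINT x|M. g x) / c"
    by (rule integral_Markov_inequality_measure[OF int(1) sets.top _ c]) (simp add: g_def)
  ultimately have "prob {x \<in> space M. g x \<ge> c} \<le> real (card E) * (\<epsilon>\<^sup>2 / 3) / c"
    using c by (meson divide_right_mono less_imp_le order_trans)
  also have "\<dots> = 2 / 3 * \<epsilon>" using cE \<epsilon> by (simp add: c_def field_simps power2_eq_square)
  also have "\<dots> < \<epsilon>" using \<epsilon> by simp
  finally have bad: "prob {x \<in> space M. g x \<ge> c} < \<epsilon>" .
  define G where "G = {x \<in> space M. g x < c}"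
  have gm: "g \<in> borel_measurable M" using int(1) by (rule borel_measurable_integrable)
  have "prob G = 1 - prob {x \<in> space M. g x \<ge> c}"
  proof -
    have "G = space M - {x \<in> space M. g x \<ge> c}" by (auto simp: G_def)
    moreover have "{x \<in> space M. g x \<ge> c} \<in> sets M" using gm by measurable
    ultimately show ?thesis by (simp only: prob_compl)
  qed
  then have G: "prob G > 1 - \<epsilon>" using bad by simp
  define pt where "pt T = (SOME x. x \<in> G \<and> pattern S x = T)" for T
  have pt: "pt (pattern S y) \<in> G" "pattern S (pt (pattern S y)) = pattern S y" if "y \<in> G" for y
  proof -
    have "\<exists>x. x \<in> G \<and> pattern S x = pattern S y" using that by blast
    from someI_ex[OF this] show "pt (pattern S y) \<in> G" "pattern S (pt (pattern S y)) = pattern S y"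
      unfolding pt_def by blast+
  qed
  define D where "D = pt ` pattern S ` G"
  have fin: "pattern S ` G \<subseteq> Pow S" using pattern_in_Pow by (rule image_subsetI)
  have finS: "finite (pattern S ` G)" using fin S(1) by (rule finite_subset[OF _ finite_Pow_iff[THEN iffD2]])
  have "card D \<le> card (pattern S ` G)" unfolding D_def by (rule card_image_le[OF finS])
  also have "\<dots> \<le> card (Pow S)" using fin S(1) by (intro card_mono) auto
  finally have card: "card D \<le> 2 ^ card S" using S(1) by (simp add: card_Pow)
  have cover: "G \<subseteq> (\<Union>x\<in>D. hball M E x \<epsilon>)"
  proof
    fix y assume y: "y \<in> G"
    define x where "x = pt (pattern S y)"
    have x: "x \<in> G" "pattern S x = pattern S y" unfolding x_def using pt[OF y] by blast+
    \<comment> \<open>Points with the same pattern get the same guess, so a partition that separates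
      them is wrong for at least one of them.\<close>
    have sub: "{\<alpha>\<in>E. \<not> (\<exists>A\<in>\<alpha>. x \<in> A \<and> y \<in> A)} \<subseteq> {\<alpha>\<in>E. x \<in> N \<alpha>} \<union> {\<alpha>\<in>E. y \<in> N \<alpha>}"
    proof
      fix \<alpha> assume "\<alpha> \<in> {\<alpha>\<in>E. \<not> (\<exists>A\<in>\<alpha>. x \<in> A \<and> y \<in> A)}"
      then have \<alpha>: "\<alpha> \<in> E" "\<not> (\<exists>A\<in>\<alpha>. x \<in> A \<and> y \<in> A)" by auto
      have "f \<alpha> (pattern S y) \<in> \<alpha>" using f(1)[OF \<alpha>(1)] by blast
      then have "x \<notin> f \<alpha> (pattern S x) \<or> y \<notin> f \<alpha> (pattern S y)" using \<alpha>(2) x(2) by auto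
      then show "\<alpha> \<in> {\<alpha>\<in>E. x \<in> N \<alpha>} \<union> {\<alpha>\<in>E. y \<in> N \<alpha>}"
        using \<alpha>(1) x(1) y by (auto simp: N_def error_set_def G_def)
    qed
    have "card {\<alpha>\<in>E. \<not> (\<exists>A\<in>\<alpha>. x \<in> A \<and> y \<in> A)} \<le> card ({\<alpha>\<in>E. x \<in> N \<alpha>} \<union> {\<alpha>\<in>E. y \<in> N \<alpha>})"
      using E(1) by (intro card_mono[OF _ sub]) auto
    also have "\<dots> \<le> card {\<alpha>\<in>E. x \<in> N \<alpha>} + card {\<alpha>\<in>E. y \<in> N \<alpha>}" by (rule card_Un_le)
    finally have "real (card {\<alpha>\<in>E. \<not> (\<exists>A\<in>\<alpha>. x \<in> A \<and> y \<in> A)}) \<le> g x + g y"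
      by (simp add: g_def)
    also have "\<dots> < real (card E) * \<epsilon>" using x(1) y by (simp add: G_def c_def)
    finally have "hamming E x y < \<epsilon>" using cE by (simp add: hamming_def divide_less_eq mult.commute)
    then have "y \<in> hball M E x \<epsilon>" using y by (simp add: hball_def G_def)
    moreover have "x \<in> D" using y by (simp add: D_def x_def)
    ultimately show "y \<in> (\<Union>x\<in>D. hball M E x \<epsilon>)" by blast
  qed
  have D: "finite D" "D \<subseteq> space M"
    using finS pt(1) unfolding D_def by (auto simp: G_def)
  have "prob G \<le> prob (\<Union>x\<in>D. hball M E x \<epsilon>)"
    using cover by (rule finite_measure_mono) (use D(1) hball_measurable[OF E(1,3)] in blast)
  then show ?thesis using G D card by (intro exI[of _ D]) auto
qed

text \<open>The bound \<open>2 ^ card S\<close> depends on \<epsilon> alone, since one family serves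
  every finite subset of \<open>K\<close>.\<close>

lemma uniformly_approximable_imp_bounded_mean_complexity:
  assumes K: "K \<subseteq> partitions M r" and "uniformly_approximable M K"
  shows "bounded_mean_complexity M K"
  unfolding bounded_mean_complexity_def
proof (intro allI impI)
  fix \<epsilon> :: real assume \<epsilon>: "0 < \<epsilon>"
  then have "0 < \<epsilon>\<^sup>2 / 3" by simp
  with assms(2) have "\<exists>S. finite S \<and> S \<subseteq> sets M \<and> (\<forall>\<alpha>\<in>K. approximable M \<alpha> S (\<epsilon>\<^sup>2 / 3))"
    unfolding uniformly_approximable_def by simp
  then obtain S where S: "finite S" "S \<subseteq> sets M" "\<forall>\<alpha>\<in>K. approximable M \<alpha> S (\<epsilon>\<^sup>2 / 3)"
    by (elim exE conjE)
  show "\<exists>C. \<forall>E. finite E \<and> E \<noteq> {} \<and> E \<subseteq> K \<and> pairwise (\<lambda>\<alpha> \<beta>. \<not> partition_equiv M \<alpha> \<beta>) E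
      \<longrightarrow> mean_complexity M E \<epsilon> \<le> C"
  proof (intro exI allI impI)
    fix E assume E: "finite E \<and> E \<noteq> {} \<and> E \<subseteq> K \<and> pairwise (\<lambda>\<alpha> \<beta>. \<not> partition_equiv M \<alpha> \<beta>) E"
    have "\<exists>D. finite D \<and> D \<subseteq> space M \<and> card D \<le> 2 ^ card S \<and> prob (\<Union>x\<in>D. hball M E x \<epsilon>) > 1 - \<epsilon>"
      by (rule approximable_imp_hball_cover[OF _ _ _ S(1,2) \<epsilon>, of E r])
        (use E S(3) K in \<open>auto simp: partitions_def\<close>)
    then obtain D where D: "finite D" "D \<subseteq> space M" "card D \<le> 2 ^ card S"
      "prob (\<Union>x\<in>D. hball M E x \<epsilon>) > 1 - \<epsilon>"
      by (elim exE conjE)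
    have "mean_complexity M E \<epsilon> \<le> card D"
      unfolding mean_complexity_def using D(1,2,4) by (intro Least_le exI[of _ D]) simp
    then show "mean_complexity M E \<epsilon> \<le> 2 ^ card S" using D(3) by simp
  qed
qed

text \<open>\<open>LEAST\<close> is informative only once some finite cover exists. One does,
  because the atoms of all members of \<open>E\<close> form a family approximating each of them with
  error 0.\<close>

lemma mean_complexity_attained:
  assumes E: "finite E" "E \<noteq> {}" "\<And>\<alpha>. \<alpha> \<in> E \<Longrightarrow> is_partition M r \<alpha>" and \<epsilon>: "0 < \<epsilon>"
  obtains D where "finite D" "D \<subseteq> space M" "card D = mean_complexity M E \<epsilon>"
    "prob (\<Union>x\<in>D. hball M E x \<epsilon>) > 1 - \<epsilon>"
proof -
  have U: "finite (\<Union>E)" "\<Union>E \<subseteq> sets M"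
  proof -
    have "finite \<alpha>" "\<alpha> \<subseteq> sets M" if "\<alpha> \<in> E" for \<alpha>
      using is_partitionD(1,3)[OF E(3)[OF that]] .
    then show "finite (\<Union>E)" "\<Union>E \<subseteq> sets M"
      using finite_Union[OF E(1)] by blast+
  qed
  have approx: "approximable M \<alpha> (\<Union>E) (\<epsilon>\<^sup>2 / 3)" if "\<alpha> \<in> E" for \<alpha>
  proof -
    have "approximable M \<alpha> (\<Union>E) 0"
      using that is_partitionD(3)[OF E(3)[OF that]] approximable_self[OF E(3)[OF that]]
      by (intro approximable_superset[OF U, of \<alpha>]) auto
    then show ?thesis by (rule approximable_mono) simp
  qed
  let ?Q = "\<lambda>k. \<exists>D. finite D \<and> D \<subseteq> space M \<and> card D = k \<and> prob (\<Union>x\<in>D. hball M E x \<epsilon>) > 1 - \<epsilon>"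
  have "\<exists>k. ?Q k"
    using approximable_imp_hball_cover[OF E U \<epsilon> approx] by auto
  then have "?Q (mean_complexity M E \<epsilon>)"
    unfolding mean_complexity_def by (rule LeastI_ex)
  then show ?thesis using that by (elim exE conjE)
qed

text \<open>The Hamming balls themselves serve as the approximating family: an average over \<open>E\<close> shows
  that at least half of the partitions in \<open>E\<close> are nearly constant on them.\<close>

lemma hball_cover_imp_many_approximable:
  assumes E: "finite E" "E \<noteq> {}" "\<And>\<alpha>. \<alpha> \<in> E \<Longrightarrow> is_partition M r \<alpha>"
    and \<epsilon>: "0 < \<epsilon>" and D: "finite D" "D \<subseteq> space M" "prob (\<Union>x\<in>D. hball M E x \<epsilon>) > 1 - \<epsilon>"
  obtains S where "finite S" "S \<subseteq> sets M" "card S \<le> card D"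
    "card E \<le> 2 * card {\<alpha>\<in>E. approximable M \<alpha> S (4 * \<epsilon>)}"
proof -
  define S where "S = (\<lambda>x. hball M E x \<epsilon>) ` D"
  define U where "U = (\<Union>x\<in>D. hball M E x \<epsilon>)"
  have S: "finite S" "S \<subseteq> sets M" "card S \<le> card D"
    unfolding S_def using D(1) hball_measurable[OF E(1,3)] by (auto intro: card_image_le)
  have U: "U \<in> sets M" unfolding U_def using D(1) hball_measurable[OF E(1,3)] by blast
  \<comment> \<open>The pattern records which balls contain \<open>y\<close>; \<open>ctr\<close>
    picks the centre of one of them.\<close>
  define ctr where "ctr T = (SOME x. x \<in> D \<and> hball M E x \<epsilon> \<in> T)" for T
  have ctr: "y \<in> hball M E (ctr (pattern S y)) \<epsilon>" if "y \<in> U" for y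
  proof -
    have "\<exists>x. x \<in> D \<and> hball M E x \<epsilon> \<in> pattern S y"
      using that by (auto simp: U_def S_def pattern_def)
    from someI_ex[OF this] show ?thesis unfolding ctr_def by (auto simp: pattern_def)
  qed
  \<comment> \<open>Guess the atom of the centre. If \<alpha> misses the centre,
    \<open>hamming\<close> counts \<alpha> as separating it from every point, so the arbitrary
    default is already paid for.\<close>
  define f where "f \<alpha> T = (if \<exists>A\<in>\<alpha>. ctr T \<in> A then SOME A. A \<in> \<alpha> \<and> ctr T \<in> A else SOME A. A \<in> \<alpha>)" for \<alpha> T
  have f1: "f \<alpha> T \<in> \<alpha> \<and> ctr T \<in> f \<alpha> T" if "\<exists>A\<in>\<alpha>. ctr T \<in> A" for \<alpha> T
  proof -
    have "\<exists>A. A \<in> \<alpha> \<and> ctr T \<in> A" using that by blast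
    from someI_ex[OF this] that show ?thesis by (simp add: f_def)
  qed
  have f: "range (f \<alpha>) \<subseteq> \<alpha>" if "\<alpha> \<in> E" for \<alpha>
  proof (rule image_subsetI)
    fix T
    have "(SOME A. A \<in> \<alpha>) \<in> \<alpha>" using is_partition_nonempty[OF E(3)[OF that]] by (simp add: some_in_eq)
    then show "f \<alpha> T \<in> \<alpha>" using f1[of \<alpha> T] by (cases "\<exists>A\<in>\<alpha>. ctr T \<in> A") (simp_all add: f_def)
  qed
  define N where "N \<alpha> = error_set M S (f \<alpha>)" for \<alpha>
  have N_sets: "N \<alpha> \<in> sets M" if "\<alpha> \<in> E" for \<alpha>
    unfolding N_def using S(1,2) f[OF that] is_partitionD(3)[OF E(3)[OF that]]
    by (intro error_set_measurable) auto
  have cE: "real (card E) > 0" using E(1,2) by (simp add: card_gt_0_iff)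
  \<comment> \<open>On \<open>U\<close> a wrong guess means that the partition separates
    \<open>y\<close> from its centre, which happens for a proportion below \<epsilon>; off
    \<open>U\<close> all guesses may be wrong.\<close>
  have pointwise: "real (card {\<alpha>\<in>E. y \<in> N \<alpha>}) \<le> real (card E) * (\<epsilon> + indicator (space M - U) y)"
    if "y \<in> space M" for y
  proof (cases "y \<in> U")
    case True
    let ?c = "ctr (pattern S y)"
    have sub: "{\<alpha>\<in>E. y \<in> N \<alpha>} \<subseteq> {\<alpha>\<in>E. \<not> (\<exists>A\<in>\<alpha>. ?c \<in> A \<and> y \<in> A)}"
    proof
      fix \<alpha> assume "\<alpha> \<in> {\<alpha>\<in>E. y \<in> N \<alpha>}"
      then have \<alpha>: "\<alpha> \<in> E" "y \<notin> f \<alpha> (pattern S y)" by (auto simp: N_def error_set_def)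
      have "A = f \<alpha> (pattern S y)" if "A \<in> \<alpha>" "?c \<in> A" for A
        using f1[of \<alpha> "pattern S y"] that disjointD[OF is_partitionD(4)[OF E(3)[OF \<alpha>(1)]]] by blast
      then show "\<alpha> \<in> {\<alpha>\<in>E. \<not> (\<exists>A\<in>\<alpha>. ?c \<in> A \<and> y \<in> A)}" using \<alpha> by auto
    qed
    have "real (card {\<alpha>\<in>E. y \<in> N \<alpha>}) \<le> real (card {\<alpha>\<in>E. \<not> (\<exists>A\<in>\<alpha>. ?c \<in> A \<and> y \<in> A)})"
      using E(1) by (intro of_nat_mono card_mono[OF _ sub]) auto
    also have "\<dots> = real (card E) * hamming E ?c y" using cE by (simp add: hamming_def)
    also have "\<dots> \<le> real (card E) * \<epsilon>"
      using ctr[OF True] cE by (simp add: hball_def)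
    finally show ?thesis using True by simp
  next
    case False
    have "card {\<alpha>\<in>E. y \<in> N \<alpha>} \<le> card E" using E(1) by (intro card_mono) auto
    then have "real (card {\<alpha>\<in>E. y \<in> N \<alpha>}) \<le> real (card E) * 1" by simp
    also have "\<dots> \<le> real (card E) * (\<epsilon> + indicator (space M - U) y)"
      using False that \<epsilon> by (intro mult_left_mono) auto
    finally show ?thesis .
  qed
  have int: "integrable M (\<lambda>y. real (card E) * (\<epsilon> + indicator (space M - U) y))"
    using U by (simp add: emeasure_eq_measure)
  have "(\<Sum>\<alpha>\<in>E. prob (N \<alpha>)) = (LINT y|M. real (card {\<alpha>\<in>E. y \<in> N \<alpha>}))"
    using integral_card_sets(2)[OF E(1) N_sets] by simp
  also have "\<dots> \<le> (LINT y|M. real (card E) * (\<epsilon> + indicator (space M - U) y))"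
    using pointwise by (intro integral_mono integral_card_sets(1)[OF E(1) N_sets] int)
  also have "\<dots> = real (card E) * (\<epsilon> + prob (space M - U))"
    using U by (simp add: prob_space emeasure_eq_measure)
  also have "\<dots> \<le> real (card E) * (2 * \<epsilon>)"
    using D(3) U unfolding U_def[symmetric] by (intro mult_left_mono) (auto simp: prob_compl)
  finally have sum_le: "(\<Sum>\<alpha>\<in>E. prob (N \<alpha>)) \<le> 2 * \<epsilon> * real (card E)"
    by (simp add: mult_ac)
  let ?G = "{\<alpha>\<in>E. approximable M \<alpha> S (4 * \<epsilon>)}"
  have bad: "4 * \<epsilon> \<le> prob (N \<alpha>)" if "\<alpha> \<in> E - ?G" for \<alpha>
  proof (rule ccontr)
    assume "\<not> 4 * \<epsilon> \<le> prob (N \<alpha>)"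
    then have "approximable M \<alpha> S (4 * \<epsilon>)"
      unfolding approximable_def using f[of \<alpha>] that by (intro exI[of _ "f \<alpha>"]) (auto simp: N_def)
    then show False using that by auto
  qed
  \<comment> \<open>Markov's inequality over \<open>E\<close>: the mean error is at most
    2\<epsilon>, so at most half of the partitions have error 4\<epsilon> or more.\<close>
  have "4 * \<epsilon> * real (card (E - ?G)) = (\<Sum>\<alpha>\<in>E-?G. 4 * \<epsilon>)" by simp
  also have "\<dots> \<le> (\<Sum>\<alpha>\<in>E-?G. prob (N \<alpha>))" using bad by (rule sum_mono)
  also have "\<dots> \<le> (\<Sum>\<alpha>\<in>E. prob (N \<alpha>))" using E(1) by (intro sum_mono2) auto
  also note sum_le
  finally have "2 * \<epsilon> * (2 * real (card (E - ?G))) \<le> 2 * \<epsilon> * real (card E)" by simp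
  then have "2 * real (card (E - ?G)) \<le> real (card E)" using \<epsilon> by simp
  then have "2 * card (E - ?G) \<le> card E" by linarith
  moreover have "card (E - ?G) = card E - card ?G"
    using E(1) by (intro card_Diff_subset) auto
  moreover have "card ?G \<le> card E" using E(1) by (intro card_mono) auto
  ultimately have "card E \<le> 2 * card ?G" by linarith
  then show ?thesis using S by (intro that)
qed

text \<open>With labelled atoms, guesses become maps from subfamilies of \<open>S\<close> to labels,
  of which there are at most \<open>r ^ (2 ^ card S)\<close>. If two partitions share such a map,
  their labels agree off both error sets, so each is approximable from the other.\<close>

lemma approximable_pigeonhole:
  assumes G: "finite G" "\<And>\<alpha>. \<alpha> \<in> G \<Longrightarrow> is_partition M r \<alpha>"
    and S: "finite S" "S \<subseteq> sets M" "\<And>\<alpha>. \<alpha> \<in> G \<Longrightarrow> approximable M \<alpha> S \<theta>"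
    and card: "r ^ (2 ^ card S) < card G"
  obtains \<alpha> \<beta> where "\<alpha> \<in> G" "\<beta> \<in> G" "\<alpha> \<noteq> \<beta>" "approximable M \<alpha> \<beta> (2 * \<theta>)" "approximable M \<beta> \<alpha> (2 * \<theta>)"
proof -
  have "\<exists>f. range f \<subseteq> \<alpha> \<and> prob (error_set M S f) \<le> \<theta>" if "\<alpha> \<in> G" for \<alpha>
    using S(3)[OF that] by (simp add: approximable_def)
  then obtain f where f: "\<And>\<alpha>. \<alpha> \<in> G \<Longrightarrow> range (f \<alpha>) \<subseteq> \<alpha>"
    "\<And>\<alpha>. \<alpha> \<in> G \<Longrightarrow> prob (error_set M S (f \<alpha>)) \<le> \<theta>"
    by metis
  have "\<exists>e::'a set \<Rightarrow> nat. inj_on e \<alpha> \<and> e ` \<alpha> \<subseteq> {..<r}" if "\<alpha> \<in> G" for \<alpha>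
    using ex_labelling[OF G(2)[OF that]] is_partition_nonempty[OF G(2)[OF that]] by (metis equals0I)
  then obtain e :: "'a set set \<Rightarrow> 'a set \<Rightarrow> nat" where
    e: "\<And>\<alpha>. \<alpha> \<in> G \<Longrightarrow> inj_on (e \<alpha>) \<alpha>" "\<And>\<alpha>. \<alpha> \<in> G \<Longrightarrow> e \<alpha> ` \<alpha> \<subseteq> {..<r}"
    by metis
  define g where "g \<alpha> = restrict (\<lambda>T. e \<alpha> (f \<alpha> T)) (Pow S)" for \<alpha>
  have "g ` G \<subseteq> Pow S \<rightarrow>\<^sub>E {..<r}"
    using e(2) f(1) unfolding g_def by (auto simp: image_subset_iff)
  then have "card (g ` G) \<le> card (Pow S \<rightarrow>\<^sub>E {..<r})"
    using S(1) by (intro card_mono finite_PiE) auto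
  also have "\<dots> = r ^ (2 ^ card S)" using S(1) by (simp add: card_PiE card_Pow)
  finally have "card (g ` G) < card G" using card by simp
  then have "\<not> inj_on g G" by (metis card_image less_irrefl)
  then obtain \<alpha> \<beta> where \<alpha>\<beta>: "\<alpha> \<in> G" "\<beta> \<in> G" "\<alpha> \<noteq> \<beta>" "g \<alpha> = g \<beta>" by (auto simp: inj_on_def)
  have "approximable M \<alpha> \<beta> (2 * \<theta>)" if \<alpha>: "\<alpha> \<in> G" and \<beta>: "\<beta> \<in> G" and eq: "g \<alpha> = g \<beta>" for \<alpha> \<beta>
  proof -
    have sets: "\<alpha> \<subseteq> sets M" "\<beta> \<subseteq> sets M" and nonempty: "\<alpha> \<noteq> {}"
      using is_partitionD(3)[OF G(2)] is_partition_nonempty[OF G(2)] \<alpha> \<beta> by blast+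
    define N where "N \<alpha> = error_set M S (f \<alpha>)" for \<alpha>
    have N_sets: "N \<alpha> \<in> sets M" "N \<beta> \<in> sets M"
      unfolding N_def
      by (intro error_set_measurable S(1,2) order_trans[OF f(1)] \<alpha> \<beta> sets)+
    have ef: "e \<alpha> (f \<alpha> T) = e \<beta> (f \<beta> T)" if "T \<in> Pow S" for T
      using fun_cong[OF eq, of T] that by (simp add: g_def)
    \<comment> \<open>\<open>h\<close> transfers the label of the atom of \<beta> to the atom of
      \<alpha> with the same label.\<close>
    define h where "h U = (if \<exists>A\<in>\<alpha>. e \<alpha> A \<in> e \<beta> ` U then SOME A. A \<in> \<alpha> \<and> e \<alpha> A \<in> e \<beta> ` U
      else SOME A. A \<in> \<alpha>)" for U
    have h1: "h U \<in> \<alpha> \<and> e \<alpha> (h U) \<in> e \<beta> ` U" if "\<exists>A\<in>\<alpha>. e \<alpha> A \<in> e \<beta> ` U" for U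
    proof -
      have "\<exists>A. A \<in> \<alpha> \<and> e \<alpha> A \<in> e \<beta> ` U" using that by blast
      from someI_ex[OF this] that show ?thesis by (simp add: h_def)
    qed
    have h: "range h \<subseteq> \<alpha>"
    proof (rule image_subsetI)
      fix U
      have "(SOME A. A \<in> \<alpha>) \<in> \<alpha>" using nonempty by (simp add: some_in_eq)
      then show "h U \<in> \<alpha>" using h1[of U] by (cases "\<exists>A\<in>\<alpha>. e \<alpha> A \<in> e \<beta> ` U") (simp_all add: h_def)
    qed
    have sub: "error_set M \<beta> h \<subseteq> N \<alpha> \<union> N \<beta>"
    proof
      fix x assume x: "x \<in> error_set M \<beta> h"
      show "x \<in> N \<alpha> \<union> N \<beta>"
      proof (rule ccontr)
        assume nx: "x \<notin> N \<alpha> \<union> N \<beta>"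
        let ?T = "pattern S x"
        have xf: "x \<in> f \<alpha> ?T" "x \<in> f \<beta> ?T" using x nx by (auto simp: N_def error_set_def)
        have mem: "f \<alpha> ?T \<in> \<alpha>" "f \<beta> ?T \<in> \<beta>" using f(1) \<alpha> \<beta> by blast+
        have p: "pattern \<beta> x = {f \<beta> ?T}"
          using is_partitionD(4)[OF G(2)[OF \<beta>]] mem(2) xf(2) by (rule pattern_partition)
        have "e \<alpha> (f \<alpha> ?T) = e \<beta> (f \<beta> ?T)" by (rule ef[OF pattern_in_Pow])
        then have "h (pattern \<beta> x) \<in> \<alpha> \<and> e \<alpha> (h (pattern \<beta> x)) \<in> e \<beta> ` pattern \<beta> x"
          using mem(1) p by (intro h1) auto
        then have "h (pattern \<beta> x) = f \<alpha> ?T"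
          using p ef[OF pattern_in_Pow, of x] mem(1) inj_onD[OF e(1)[OF \<alpha>]] by auto
        then show False using x xf(1) by (simp add: error_set_def)
      qed
    qed
    have "prob (error_set M \<beta> h) \<le> prob (N \<alpha> \<union> N \<beta>)"
      using sub N_sets by (intro finite_measure_mono) auto
    also have "\<dots> \<le> prob (N \<alpha>) + prob (N \<beta>)" using N_sets by (rule measure_Un_le)
    also have "\<dots> \<le> 2 * \<theta>" using f(2)[OF \<alpha>] f(2)[OF \<beta>] by (simp add: N_def)
    finally show ?thesis using h by (auto simp: approximable_def)
  qed
  from this[OF \<alpha>\<beta>(1,2,4)] this[OF \<alpha>\<beta>(2,1) \<alpha>\<beta>(4)[symmetric]] that[OF \<alpha>\<beta>(1-3)]
  show ?thesis by simp
qed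

text \<open>A long initial piece of the greedy sequence is covered by boundedly many balls. Half of
  its partitions are then approximable from a family of bounded size, and the pigeonhole principle
  makes two of them close, against their separation.\<close>

lemma bounded_mean_complexity_imp_uniformly_approximable:
  assumes K: "K \<subseteq> partitions M r" and "bounded_mean_complexity M K"
  shows "uniformly_approximable M K"
proof (rule ccontr)
  assume "\<not> uniformly_approximable M K"
  from not_uniformly_approximable_sequence[OF K this] obtain \<eta> a where \<eta>: "0 < \<eta>"
    and a: "\<And>n::nat. a n \<in> K" "\<And>m n. m < n \<Longrightarrow> \<not> approximable M (a n) (a m) \<eta>" by metis
  have part: "is_partition M r (a n)" for n using a(1) K by (auto simp: partitions_def)
  \<comment> \<open>Makes initial pieces of the sequence admissible in the definition of bounded
    mean complexity, and, by reflexivity of the equivalence, the sequence injective.\<close>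
  have not_equiv: "\<not> partition_equiv M (a m) (a n)" if "m \<noteq> n" for m n
  proof
    assume "partition_equiv M (a m) (a n)"
    moreover from this have "partition_equiv M (a n) (a m)" by (simp add: partition_equiv_def)
    ultimately have "approximable M (a m) (a n) 0" "approximable M (a n) (a m) 0"
      using approximable_equiv part by blast+
    then show False using a(2)[of m n] a(2)[of n m] that \<eta> approximable_mono[of _ _ 0 \<eta>]
      by (metis less_imp_le nat_neq_iff)
  qed
  have "partition_equiv M (a n) (a n)" for n
    unfolding partition_equiv_def union_mod0_def by (auto intro!: exI[of _ "{_}"])
  then have inj: "inj a" using not_equiv by (metis injI)
  \<comment> \<open>The balls give error 4\<epsilon> and the pigeonhole step doubles it, which makes
    \<eta>.\<close>
  define \<epsilon> where "\<epsilon> = \<eta> / 8"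
  have \<epsilon>: "0 < \<epsilon>" using \<eta> by (simp add: \<epsilon>_def)
  have "\<exists>C. \<forall>E. finite E \<and> E \<noteq> {} \<and> E \<subseteq> K \<and> pairwise (\<lambda>\<alpha> \<beta>. \<not> partition_equiv M \<alpha> \<beta>) E
      \<longrightarrow> mean_complexity M E \<epsilon> \<le> C"
    using assms(2) \<epsilon> unfolding bounded_mean_complexity_def by simp
  then obtain C where C: "\<And>E. finite E \<Longrightarrow> E \<noteq> {} \<Longrightarrow> E \<subseteq> K
      \<Longrightarrow> pairwise (\<lambda>\<alpha> \<beta>. \<not> partition_equiv M \<alpha> \<beta>) E \<Longrightarrow> mean_complexity M E \<epsilon> \<le> C"
    by auto
  have r: "r > 0" using is_partitionD(1,2)[OF part] is_partition_nonempty[OF part]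
    by (metis card_gt_0_iff order_less_le_trans)
  \<comment> \<open>Half of \<open>n\<close> is \<open>r ^ (2 ^ C) + 1\<close>, one more than the
    number of label maps for a family of \<open>C\<close> sets.\<close>
  define n where "n = 2 * r ^ (2 ^ C) + 2"
  define E where "E = a ` {..<n}"
  have E: "finite E" "E \<noteq> {}" "E \<subseteq> K" "card E = n" and E_part: "\<And>\<alpha>. \<alpha> \<in> E \<Longrightarrow> is_partition M r \<alpha>"
    unfolding E_def using a(1) part inj by (auto simp: n_def card_image inj_on_subset)
  have "pairwise (\<lambda>\<alpha> \<beta>. \<not> partition_equiv M \<alpha> \<beta>) E"
    unfolding E_def pairwise_image using not_equiv by (auto simp: pairwise_def)
  then have mc: "mean_complexity M E \<epsilon> \<le> C" using C E by blast
  obtain D where D: "finite D" "D \<subseteq> space M" "card D = mean_complexity M E \<epsilon>"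
    "prob (\<Union>x\<in>D. hball M E x \<epsilon>) > 1 - \<epsilon>"
    by (rule mean_complexity_attained[OF E(1,2) E_part \<epsilon>])
  obtain S where S: "finite S" "S \<subseteq> sets M" "card S \<le> card D"
    "card E \<le> 2 * card {\<alpha>\<in>E. approximable M \<alpha> S (4 * \<epsilon>)}"
    by (rule hball_cover_imp_many_approximable[OF E(1,2) E_part \<epsilon> D(1,2,4)])
  define G where "G = {\<alpha>\<in>E. approximable M \<alpha> S (4 * \<epsilon>)}"
  have G: "finite G" "\<And>\<alpha>. \<alpha> \<in> G \<Longrightarrow> is_partition M r \<alpha>" "\<And>\<alpha>. \<alpha> \<in> G \<Longrightarrow> approximable M \<alpha> S (4 * \<epsilon>)"
    unfolding G_def using E(1) E_part by auto
  have "r ^ (2 ^ card S) \<le> r ^ (2 ^ C)"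
    using r S(3) D(3) mc by (intro power_increasing) auto
  also have "\<dots> < card G" using S(4) unfolding G_def[symmetric] E(4) n_def by simp
  finally have card: "r ^ (2 ^ card S) < card G" .
  obtain \<alpha> \<beta> where \<alpha>\<beta>: "\<alpha> \<in> G" "\<beta> \<in> G" "\<alpha> \<noteq> \<beta>"
    "approximable M \<alpha> \<beta> (2 * (4 * \<epsilon>))" "approximable M \<beta> \<alpha> (2 * (4 * \<epsilon>))"
    by (rule approximable_pigeonhole[OF G(1,2) S(1,2) G(3) card])
  then obtain i j where ij: "\<alpha> = a i" "\<beta> = a j" "i \<noteq> j" by (auto simp: G_def E_def)
  have "approximable M (a i) (a j) \<eta>" "approximable M (a j) (a i) \<eta>"
    using \<alpha>\<beta>(4,5) ij by (simp_all add: \<epsilon>_def)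
  then show False using a(2)[of i j] a(2)[of j i] ij(3) by (metis nat_neq_iff)
qed

end

section \<open>Linking the four conditions through uniform approximability\<close>

theorem theorem1p1:
  fixes M :: "'a::polish_space measure" and r :: nat and K :: "'a set set set"
  assumes "prob_space M"
    and "sets M = sets borel"
    and "r \<ge> 2"
    and "K \<subseteq> partitions M r"
  shows "(rho_precompact M r K \<longleftrightarrow> max_pattern_entropy M K = 0)
       \<and> (max_pattern_entropy M K = 0 \<longleftrightarrow> L2_precompact M (atom_indicators K))
       \<and> (L2_precompact M (atom_indicators K) \<longleftrightarrow> bounded_mean_complexity M K)"
proof -
  interpret prob_space M by fact
  note K = \<open>K \<subseteq> partitions M r\<close>
  have "rho_precompact M r K \<longleftrightarrow> uniformly_approximable M K"
    using rho_precompact_imp_uniformly_approximable[OF K]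
      uniformly_approximable_imp_rho_precompact[OF K] by blast
  moreover have "max_pattern_entropy M K = 0 \<longleftrightarrow> uniformly_approximable M K"
    using max_pattern_entropy_imp_uniformly_approximable[OF K]
      uniformly_approximable_imp_max_pattern_entropy[OF K] by blast
  moreover have "L2_precompact M (atom_indicators K) \<longleftrightarrow> uniformly_approximable M K"
    using L2_precompact_imp_uniformly_approximable[OF K]
      uniformly_approximable_imp_L2_precompact[OF K] by blast
  moreover have "bounded_mean_complexity M K \<longleftrightarrow> uniformly_approximable M K"
    using bounded_mean_complexity_imp_uniformly_approximable[OF K]
      uniformly_approximable_imp_bounded_mean_complexity[OF K] by blast
  ultimately show ?thesis by blast
qed

end
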